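(* Let $p$ be a prime, $X=\mathbb{P}^1$ over $\mathbb{C}$, $x_1,\dots,x_r\in\mathbb{C}$ distinct points ($r\ge1$), $\mathfrak{R}=\{x_1,\dots,x_r\}$, and $v_1,\dots,v_r$ integers with $0<v_i<p$ and $\sum_i v_i\equiv0\bmod p$. Let $Y$ be the normalization of (the projective completion of) the superelliptic curve $$y^p=f(x)=(x-x_1)^{v_1}\cdots(x-x_r)^{v_r},$$ with $\pi:Y\to X$, $(x,y)\mapsto x$. Let $\zeta=e^{2\pi i/p}$, let $\chi:\mathcal{C}_p\to\mu_p\subseteq\mathbb{C}^*$ be a nontrivial character, with $\mathcal{C}_p$ identified with $\operatorname{Gal}(Y/X)$ by letting $g\in\mathcal{C}_p$ act by $(x,y)\mapsto(x,\chi(g)y)$, and let $\tau\in\operatorname{Gal}(Y/X)$ be the nontrivial automorphism with $\chi(\tau)=\zeta$, i.e. $\tau:(x,y)\mapsto(x,\zeta y)$. Then the algebraic rotation data $$\big(\log_\zeta\langle\tau_x,z_x\rangle_x\big)_{x\in\mathfrak{R}}\in\prod_{x\in\mathfrak{R}}\mathbb{Z}/(p)$$ of $\tau$ coincides with the classical analytic rotation data $(\rho_x)_{x\in\mathfrak{R}}$ of $\tau$.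
   Context: Algebraic rotation data. For a closed point $x\in X$, $K_x$ is the fraction field of the completed local ring at $x$, and $z_x$ a uniformizer at $x$, so $K_x\simeq\mathbb{C}((z_x))$. The valuation induces $K_x^*/K_x^{*p}\simeq\mathbb{Z}/(p)$, and there is a unique (up to isomorphism) degree-$p$ extension $E_x/K_x$, obtained by adjoining a $p$-th root of any non-$p$-th power. The Kummer pairing is $$\langle g,\lambda\rangle_x=\frac{g(\lambda^{1/p})}{\lambda^{1/p}}:\operatorname{Gal}(E_x/K_x)\times K_x^*/K_x^{*p}\to\mu_p,$$ with $\lambda^{1/p}$ any $p$-th root of $\lambda$ in $E_x$. For $x\in\mathfrak{R}$, the local algebra of $Y$ above $x$, namely $K_x\otimes_{\mathbb{C}(x)}\mathbb{C}(Y)=K_x[y]/(y^p-f)$, is a field isomorphic to $E_x$, and $\tau$ induces on it an element $\tau_x\in\operatorname{Gal}(E_x/K_x)$ ($y\mapsto\zeta y$). $\log_\zeta:\mu_p\to\mathbb{Z}/(p)$ is the discrete logarithm, $\log_\zeta(\zeta^a)=a\bmod p$. Analytic rotation data. For $x=x_i\in\mathfrak{R}$, $\tau$ fixes the unique point of $Y$ over $x$ and rotates a small disk around it by an angle $2\pi\rho_x/p$ (that is, in a local coordinate $w$ centered at that point, $w\circ\tau=e^{2\pi i\rho_x/p}w+O(w^2)$); the class $\rho_x\bmod p$ is the rotation number of $\tau$ at $x$. *)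

theory Defs
  imports
    "HOL-Complex_Analysis.Complex_Analysis"
    "HOL-Library.Landau_Symbols"
    "HOL-Number_Theory.Residues"
    "HOL-Algebra.Bij"
    "HOL-Algebra.QuotRing"
    "HOL-Algebra.Elementary_Groups"
    "HOL-Algebra.Algebraic_Closure_Type"
begin

section \<open>Riemann surfaces\<close>

text \<open>
  A coordinate is a pair of an open set and a function that is relevant on that set only;
  \<open>inv_into U w\<close> is the inverse parametrisation.
\<close>

type_synonym 'a coordinate = "'a set \<times> ('a \<Rightarrow> complex)"

definition is_chart :: "'a topology \<Rightarrow> 'a coordinate \<Rightarrow> bool" where
  "is_chart Y = (\<lambda>(U, w). openin Y U \<and> open (w ` U) \<and>
     homeomorphic_map (subtopology Y U) (top_of_set (w ` U)) w)"

definition holomorphic_transition :: "'a coordinate \<Rightarrow> 'a coordinate \<Rightarrow> bool" where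
  "holomorphic_transition = (\<lambda>(U, w) (V, u).
     (\<lambda>t. u (inv_into U w t)) holomorphic_on w ` (U \<inter> V))"

definition riemann_surface :: "'a topology \<Rightarrow> 'a coordinate set \<Rightarrow> bool" where
  "riemann_surface Y A \<longleftrightarrow>
     Hausdorff_space Y \<and> connected_space Y \<and>
     (\<forall>c\<in>A. is_chart Y c) \<and>
     (\<Union>(U, w)\<in>A. U) = topspace Y \<and>
     (\<forall>c\<in>A. \<forall>d\<in>A. holomorphic_transition c d)"

text \<open>A local coordinate need not belong to the given atlas, only to the maximal one.\<close>

definition local_coordinate_at ::
    "'a topology \<Rightarrow> 'a coordinate set \<Rightarrow> 'a \<Rightarrow> 'a coordinate \<Rightarrow> bool" where
  "local_coordinate_at Y A q = (\<lambda>(U, w).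
     is_chart Y (U, w) \<and>
     (\<forall>c\<in>A. holomorphic_transition (U, w) c \<and> holomorphic_transition c (U, w)) \<and>
     q \<in> U \<and> w q = 0)"

definition holomorphic_self_map ::
    "'a topology \<Rightarrow> 'a coordinate set \<Rightarrow> ('a \<Rightarrow> 'a) \<Rightarrow> bool" where
  "holomorphic_self_map Y A g \<longleftrightarrow>
     continuous_map Y Y g \<and>
     (\<forall>(U, w)\<in>A. \<forall>(V, u)\<in>A.
        (\<lambda>t. u (g (inv_into U w t))) holomorphic_on w ` {q \<in> U. g q \<in> V})"


section \<open>Maps to complex projective space\<close>

text \<open>
  The point of projective space with homogeneous coordinates \<open>a \<noteq> 0\<close> is the complex line
  spanned by \<open>a\<close>.
\<close>

definition hpoint :: "complex ^ 'n \<Rightarrow> (complex ^ 'n) set" where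
  "hpoint a = range (\<lambda>c. c *s a)"

definition holomorphic_to_projective ::
    "'a topology \<Rightarrow> 'a coordinate set \<Rightarrow> ('a \<Rightarrow> (complex ^ 'n) set) \<Rightarrow> bool" where
  "holomorphic_to_projective Y A h \<longleftrightarrow>
     (\<forall>q\<in>topspace Y. \<exists>(U, w)\<in>A. \<exists>D F. q \<in> U \<and> open D \<and> w q \<in> D \<and> D \<subseteq> w ` U \<and>
        (\<forall>i. (\<lambda>t. F t $ i) holomorphic_on D) \<and>
        (\<forall>t\<in>D. F t \<noteq> 0 \<and> h (inv_into U w t) = hpoint (F t)))"


section \<open>The superelliptic curve and its normalization\<close>

definition superelliptic_poly :: "nat \<Rightarrow> (nat \<Rightarrow> complex) \<Rightarrow> (nat \<Rightarrow> nat) \<Rightarrow> complex poly" where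
  "superelliptic_poly r x v = (\<Prod>i=1..r. [:- x i, 1:] ^ v i)"

text \<open>
  The projective closure in the projective plane of the affine curve \<open>y^p = f(x)\<close>, for \<open>f \<noteq> 0\<close>:
  the equation is homogenized to its degree, in homogeneous coordinates \<open>[x : y : z]\<close>.
\<close>

definition projective_completion :: "nat \<Rightarrow> complex poly \<Rightarrow> (complex ^ 3) set set" where
  "projective_completion p f =
     (let N = max p (Polynomial.degree f) in
      hpoint ` {a. a \<noteq> 0 \<and>
        (a $ 2) ^ p * (a $ 3) ^ (N - p) =
        (\<Sum>k\<le>Polynomial.degree f. Polynomial.coeff f k * (a $ 1) ^ k * (a $ 3) ^ (N - k))})"

text \<open>
  The normalization of an irreducible projective plane curve \<open>C\<close>, as a Riemann surface: it is a
  compact Riemann surface with a holomorphic map onto \<open>C\<close> which is finite-to-one over, and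
  injective away from, a finite set of points of \<open>C\<close>.  This determines it up to a unique
  isomorphism over \<open>C\<close>.
\<close>

definition normalization_of ::
    "(complex ^ 3) set set \<Rightarrow> 'a topology \<Rightarrow> 'a coordinate set \<Rightarrow> ('a \<Rightarrow> (complex ^ 3) set) \<Rightarrow> bool"
  where
  "normalization_of C Y A \<nu> \<longleftrightarrow>
     riemann_surface Y A \<and> compact_space Y \<and>
     holomorphic_to_projective Y A \<nu> \<and> \<nu> ` topspace Y = C \<and>
     (\<exists>S. finite S \<and> finite {q \<in> topspace Y. \<nu> q \<in> S} \<and>
          inj_on \<nu> {q \<in> topspace Y. \<nu> q \<notin> S})"

text \<open>
  The map from \<open>Y\<close> to the projective line that is \<open>(x, y) \<mapsto> x\<close> on the affine part.  By the
  identity theorem these two conditions determine it, also at the points at infinity, where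
  \<open>[x : y : z] \<mapsto> [x : z]\<close> itself may be undefined.
\<close>

definition x_projection ::
    "'a topology \<Rightarrow> 'a coordinate set \<Rightarrow> ('a \<Rightarrow> (complex ^ 3) set) \<Rightarrow> ('a \<Rightarrow> (complex ^ 2) set) \<Rightarrow> bool"
  where
  "x_projection Y A \<nu> \<pi> \<longleftrightarrow>
     holomorphic_to_projective Y A \<pi> \<and>
     (\<forall>q\<in>topspace Y. \<forall>a b. \<nu> q = hpoint (vector [a, b, 1]) \<longrightarrow> \<pi> q = hpoint (vector [a, 1]))"

text \<open>The group \<open>Gal(Y/X)\<close> of biholomorphic maps of \<open>Y\<close> over \<open>X\<close>.\<close>

definition deck_group ::
    "'a topology \<Rightarrow> 'a coordinate set \<Rightarrow> ('a \<Rightarrow> 'b) \<Rightarrow> ('a \<Rightarrow> 'a) monoid" where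
  "deck_group Y A \<pi> = BijGroup (topspace Y)
     \<lparr>carrier := {g \<in> Bij (topspace Y).
        holomorphic_self_map Y A g \<and> holomorphic_self_map Y A (inv_into (topspace Y) g) \<and>
        (\<forall>q\<in>topspace Y. \<pi> (g q) = \<pi> q)}\<rparr>"

definition root_of_unity_group :: "nat \<Rightarrow> complex monoid" where
  "root_of_unity_group p = \<lparr>carrier = {c. c ^ p = 1}, monoid.mult = (*), one = 1\<rparr>"

text \<open>
  The action \<open>act\<close> identifies \<open>C\<close> with \<open>Gal(Y/X)\<close> through \<open>g : (x, y) \<mapsto> (x, chi(g) y)\<close>.
\<close>

definition identifies_with_deck_group ::
    "('g, 'm) monoid_scheme \<Rightarrow> ('g \<Rightarrow> complex) \<Rightarrow> 'a topology \<Rightarrow> 'a coordinate set \<Rightarrow>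
     ('a \<Rightarrow> (complex ^ 3) set) \<Rightarrow> ('a \<Rightarrow> (complex ^ 2) set) \<Rightarrow> ('g \<Rightarrow> 'a \<Rightarrow> 'a) \<Rightarrow> bool" where
  "identifies_with_deck_group C chi Y A \<nu> \<pi> act \<longleftrightarrow>
     act \<in> iso C (deck_group Y A \<pi>) \<and>
     (\<forall>g\<in>carrier C. \<forall>q\<in>topspace Y. \<forall>a b.
        \<nu> q = hpoint (vector [a, b, 1]) \<longrightarrow> \<nu> (act g q) = hpoint (vector [a, chi g * b, 1]))"


section \<open>Algebraic rotation data\<close>

text \<open>
  For a finite point \<open>x\<close> of the projective line, the completed local ring is the ring of formal
  power series in \<open>t = X - x\<close>, and its fraction field \<open>K\<^sub>x\<close> is \<^typ>\<open>complex fls\<close>, with the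
  valuation \<^const>\<open>fls_subdegree\<close>.
\<close>

definition expand_at :: "complex \<Rightarrow> complex poly \<Rightarrow> complex fls" where
  "expand_at x f = fps_to_fls (fps_of_poly (pcompose f [:x, 1:]))"

definition is_uniformizer :: "complex fls \<Rightarrow> bool" where
  "is_uniformizer z \<longleftrightarrow> fls_subdegree z = 1"

text \<open>\<open>K\<^sub>x[y]/(y^p - f)\<close>, with its structure map from \<open>K\<^sub>x\<close> and the class of \<open>y\<close>\<close>

definition local_ideal :: "nat \<Rightarrow> complex poly \<Rightarrow> complex \<Rightarrow> complex fls poly set" where
  "local_ideal p f x =
     PIdl\<^bsub>ring_of_type_algebra\<^esub> (Polynomial.monom 1 p - [:expand_at x f:])"

definition local_algebra :: "nat \<Rightarrow> complex poly \<Rightarrow> complex \<Rightarrow> complex fls poly set ring" where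
  "local_algebra p f x = ring_of_type_algebra Quot local_ideal p f x"

definition local_class :: "nat \<Rightarrow> complex poly \<Rightarrow> complex \<Rightarrow> complex fls poly \<Rightarrow> complex fls poly set"
  where
  "local_class p f x P = local_ideal p f x +>\<^bsub>ring_of_type_algebra\<^esub> P"

definition local_embedding :: "nat \<Rightarrow> complex poly \<Rightarrow> complex \<Rightarrow> complex fls \<Rightarrow> complex fls poly set"
  where
  "local_embedding p f x a = local_class p f x [:a:]"

definition local_y :: "nat \<Rightarrow> complex poly \<Rightarrow> complex \<Rightarrow> complex fls poly set" where
  "local_y p f x = local_class p f x [:0, 1:]"

text \<open>The elements of \<open>Gal(E/K)\<close>, for an extension \<open>E\<close> of \<open>K\<close> with structure map \<open>\<iota>\<close>\<close>

definition galois_automorphisms ::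
    "('e, 'm) ring_scheme \<Rightarrow> ('k \<Rightarrow> 'e) \<Rightarrow> ('e \<Rightarrow> 'e) set" where
  "galois_automorphisms E \<iota> =
     {g \<in> extensional (carrier E). g \<in> ring_iso E E \<and> (\<forall>a. g (\<iota> a) = \<iota> a)}"

definition local_galois :: "nat \<Rightarrow> complex poly \<Rightarrow> complex \<Rightarrow> complex \<Rightarrow>
    complex fls poly set \<Rightarrow> complex fls poly set" where
  "local_galois p f x c =
     (THE g. g \<in> galois_automorphisms (local_algebra p f x) (local_embedding p f x) \<and>
        g (local_y p f x) =
          local_embedding p f x (fls_const c) \<otimes>\<^bsub>local_algebra p f x\<^esub> local_y p f x)"

definition kummer_pairing :: "nat \<Rightarrow> ('e, 'm) ring_scheme \<Rightarrow> (complex fls \<Rightarrow> 'e) \<Rightarrow>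
    ('e \<Rightarrow> 'e) \<Rightarrow> complex fls \<Rightarrow> complex" where
  "kummer_pairing p E \<iota> g l =
     (THE c. c \<in> carrier (root_of_unity_group p) \<and>
        (\<forall>s\<in>carrier E. s [^]\<^bsub>E\<^esub> p = \<iota> l \<longrightarrow> g s \<otimes>\<^bsub>E\<^esub> inv\<^bsub>E\<^esub> s = \<iota> (fls_const c)))"

text \<open>\<open>\<int>/(p)\<close> is \<^term>\<open>residue_ring (int p)\<close>, whose elements are the integers \<open>0, \<dots>, p - 1\<close>.\<close>

definition discrete_log :: "nat \<Rightarrow> complex \<Rightarrow> complex \<Rightarrow> int" where
  "discrete_log p \<zeta> c = (THE a. a \<in> carrier (residue_ring (int p)) \<and> \<zeta> powi a = c)"

text \<open>
  Rotation datum at \<open>x\<close>, with respect to the uniformizer \<open>z\<close>, of the deck transformation that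
  multiplies \<open>y\<close> by \<open>c\<close>
\<close>

definition algebraic_rotation ::
    "nat \<Rightarrow> complex poly \<Rightarrow> complex \<Rightarrow> complex \<Rightarrow> complex \<Rightarrow> complex fls \<Rightarrow> int" where
  "algebraic_rotation p f \<zeta> c x z =
     discrete_log p \<zeta>
       (kummer_pairing p (local_algebra p f x) (local_embedding p f x) (local_galois p f x c) z)"


section \<open>Analytic rotation data\<close>

definition point_over :: "'a topology \<Rightarrow> ('a \<Rightarrow> (complex ^ 2) set) \<Rightarrow> complex \<Rightarrow> 'a" where
  "point_over Y \<pi> x = (THE q. q \<in> topspace Y \<and> \<pi> q = hpoint (vector [x, 1]))"

text \<open>
  The class \<open>\<rho>\<close> modulo \<open>p\<close> such that \<open>w \<circ> \<tau> = exp (2 \<pi> i \<rho> / p) w + O(w^2)\<close> in every local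
  coordinate \<open>w\<close> centered at the point over \<open>x\<close>, which \<open>\<tau>\<close> fixes.
\<close>

definition analytic_rotation ::
    "nat \<Rightarrow> 'a topology \<Rightarrow> 'a coordinate set \<Rightarrow> ('a \<Rightarrow> (complex ^ 2) set) \<Rightarrow> ('a \<Rightarrow> 'a) \<Rightarrow> complex \<Rightarrow> int"
  where
  "analytic_rotation p Y A \<pi> \<tau> x =
     (THE \<rho>. \<rho> \<in> carrier (residue_ring (int p)) \<and>
        \<tau> (point_over Y \<pi> x) = point_over Y \<pi> x \<and>
        (\<forall>U w. local_coordinate_at Y A (point_over Y \<pi> x) (U, w) \<longrightarrow>
           (\<lambda>t. w (\<tau> (inv_into U w t)) - exp (2 * of_real pi * \<i> * of_int \<rho> / of_nat p) * t)
             \<in> O[at 0](\<lambda>t. t ^ 2)))"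

end

theory Submission
  imports Defs
begin

text \<open>
  Fix a branch point \<open>s\<close> of exponent \<open>v\<close> and let \<open>a v \<equiv> 1\<close> modulo \<open>p\<close>; both rotation data are \<open>a\<close>.

  On the algebraic side, write \<open>f = t^v u^p\<close> in \<open>K\<^sub>x\<close> with \<open>t = X - s\<close>.  Every uniformizer is a
  \<open>p\<close>-th power times \<open>f^a\<close>, so it has a \<open>p\<close>-th root of the form \<open>k y^a\<close> with \<open>k \<in> K\<^sub>x\<close>, which the
  automorphism \<open>y \<mapsto> \<zeta> y\<close> multiplies by \<open>\<zeta>^a\<close>.  The embedding \<open>t \<mapsto> T^p\<close>, \<open>y \<mapsto> T^v u(T^p)\<close> of
  the local algebra into \<open>\<complex>((T))\<close> shows that any two \<open>p\<close>-th roots differ by a constant.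

  On the analytic side, let \<open>x - s\<close> and \<open>y\<close> vanish to orders \<open>e\<close> and \<open>n\<close> at a point of \<open>Y\<close> over \<open>s\<close>.
  Comparing orders in \<open>y^p = f(x)\<close> gives \<open>n p = e v\<close>, hence \<open>p\<close> divides \<open>e\<close>.  Since a nearby fibre
  of \<open>x\<close> has \<open>e\<close> points close to the given one but at most \<open>p\<close> points altogether, there is only one
  point over \<open>s\<close>, with \<open>e = p\<close> and \<open>n = v\<close>.  The multiplier \<open>l\<close> of \<open>\<tau>\<close> there
  satisfies \<open>l^p = 1\<close> and \<open>l^v = \<zeta>\<close>, because \<open>x \<circ> \<tau> = x\<close> and \<open>y \<circ> \<tau> = \<zeta> y\<close>; so \<open>l = \<zeta>^a\<close>.
\<close>

unbundle fps_syntax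

subsection \<open>The local algebra at a branch point\<close>

lemma fps_nth_root_exists:
  fixes u :: "complex fps"
  assumes "0 < n" "fps_nth u 0 \<noteq> 0"
  shows "\<exists>w. w ^ n = u"
proof -
  obtain m where m: "n = Suc m" using assms(1) by (cases n) auto
  obtain b where "fps_nth u 0 = b ^ n"
    using assms(1) by (rule exists_complex_root[OF less_imp_neq[symmetric]])
  \<comment> \<open>The formal radical depends on a choice of complex roots; the constant choice
    \<open>b\<close>, a root of the constant coefficient, is enough.\<close>
  then show ?thesis
    using power_radical[OF assms(2), of "\<lambda>_ _. b" m] m by auto
qed

text \<open>Dividing out the power of the variable leaves a unit of the power series ring, which has
  an \<open>n\<close>-th root. Hence only the valuation survives modulo \<open>n\<close>-th
  powers.\<close>

lemma fls_factor_nth_power: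
  fixes z :: "complex fls"
  assumes "z \<noteq> 0" "0 < n"
  obtains R where "z = fls_X_intpow (fls_subdegree z) * R ^ n" "R \<noteq> 0"
proof -
  have "fps_nth (fls_base_factor_to_fps z) 0 \<noteq> 0"
    using assms(1) by simp
  from fps_nth_root_exists[OF assms(2) this]
  obtain w where w: "w ^ n = fls_base_factor_to_fps z" by blast
  have "z = fls_X_intpow (fls_subdegree z) * fps_to_fls w ^ n"
    unfolding fps_to_fls_power[symmetric] w fps_to_fls_base_factor_to_fps
    by (rule fls_base_factor_X_power_decompose(2))
  moreover have "fps_to_fls w \<noteq> 0"
    using w assms fls_base_factor_to_fps_nonzero[OF assms(1)] by (auto simp: power_0_left simp del: fls_base_factor_def)
  ultimately show ?thesis using that by blast
qed

text \<open>Differentiating \<open>x ^ n = 1\<close> shows that the derivative of \<open>x\<close>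
  vanishes, and in characteristic 0 this makes \<open>x\<close> constant. It serves to compare two
  \<open>p\<close>-th roots of the same element.\<close>

lemma fls_unity_root_is_const:
  fixes x :: "complex fls"
  assumes "x ^ n = 1" "0 < n"
  obtains \<omega> where "x = fls_const \<omega>" "\<omega> ^ n = 1"
proof -
  have "x \<noteq> 0" using assms by (auto simp: power_0_left)
  have "of_nat n * x ^ (n - 1) * fls_deriv x = 0"
    using arg_cong[OF assms(1), of fls_deriv] by (simp add: fls_deriv_power)
  then have "fls_deriv x = 0"
    using \<open>x \<noteq> 0\<close> assms(2) by simp
  then obtain \<omega> where \<omega>: "x = fls_const \<omega>" by (auto simp: fls_deriv_eq_0_iff)
  have "fls_const (\<omega> ^ n) = fls_const 1"
    using assms(1) by (simp add: \<omega> fls_const_power)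
  then have "\<omega> ^ n = 1" by (metis fls_const_nth)
  then show ?thesis using \<omega> that by blast
qed

text \<open>
  The substitution \<open>t \<mapsto> s^p\<close>, \<open>y \<mapsto> Y\<close> into the field of Laurent series in \<open>s\<close>.  For a suitable
  \<open>Y\<close> it identifies the local algebra with a subring of that field.
\<close>

definition puiseux_eval :: "nat \<Rightarrow> complex fls \<Rightarrow> complex fls poly \<Rightarrow> complex fls" where
  "puiseux_eval p Y P = poly (map_poly (\<lambda>a. fls_compose_power a p) P) Y"

lemma puiseux_eval_0 [simp]: "puiseux_eval p Y 0 = 0"
  by (simp add: puiseux_eval_def)

lemma puiseux_eval_pCons [simp]:
  "puiseux_eval p Y (pCons a P) = fls_compose_power a p + Y * puiseux_eval p Y P"
  by (simp add: puiseux_eval_def map_poly_pCons)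

lemma puiseux_eval_add: "puiseux_eval p Y (P + Q) = puiseux_eval p Y P + puiseux_eval p Y Q"
  by (induction P Q rule: poly_induct2) (simp_all add: algebra_simps)

lemma puiseux_eval_smult: "puiseux_eval p Y (Polynomial.smult a P) = fls_compose_power a p * puiseux_eval p Y P"
  by (induction P) (simp_all add: algebra_simps)

lemma puiseux_eval_mult: "puiseux_eval p Y (P * Q) = puiseux_eval p Y P * puiseux_eval p Y Q"
  by (induction P) (simp_all add: puiseux_eval_add puiseux_eval_smult algebra_simps)

lemma puiseux_eval_diff: "puiseux_eval p Y (P - Q) = puiseux_eval p Y P - puiseux_eval p Y Q"
  using puiseux_eval_add[of p Y "P - Q" Q] by simp

lemma puiseux_eval_power: "0 < p \<Longrightarrow> puiseux_eval p Y (P ^ n) = puiseux_eval p Y P ^ n"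
  by (induction n) (simp_all add: puiseux_eval_mult one_pCons)

lemma fls_compose_power_eq_0_iff:
  assumes "0 < d"
  shows "fls_compose_power f d = 0 \<longleftrightarrow> f = 0"
proof
  assume "fls_compose_power f d = 0"
  then have "fls_compose_power f d $$ (int d * n) = 0" for n by simp
  then have "f $$ n = 0" for n using assms by (simp add: fls_nth_compose_power)
  then show "f = 0" by (simp add: fls_eq_iff)
qed simp

lemma puiseux_eval_sum:
  "0 < p \<Longrightarrow> puiseux_eval p Y P =
    (\<Sum>k\<le>Polynomial.degree P. fls_compose_power (Polynomial.coeff P k) p * Y ^ k)"
  by (simp add: puiseux_eval_def poly_altdef coeff_map_poly degree_map_poly fls_compose_power_eq_0_iff)

section \<open>Embedding the local algebra into Laurent series\<close>

locale local_superelliptic =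
  fixes p v :: nat and f :: "complex poly" and x :: complex and Rt :: "complex fls"
  assumes p0: "0 < p" and copr: "coprime v p"
    and F_eq: "expand_at x f = fls_X_intpow (int v) * Rt ^ p" and Rt0: "Rt \<noteq> 0"
begin

definition M :: "complex fls poly" where "M = Polynomial.monom 1 p - [:expand_at x f:]"

text \<open>Substituting t = s^p into f = t^v \<open>Rt\<close>^p gives s^(p v)
  \<open>Rt\<close>(s^p)^p, and this series is its evident \<open>p\<close>-th root. In the
  application \<open>Rt\<close> is a \<open>p\<close>-th root of the factor of \<open>f\<close> that
  does not vanish at \<open>x\<close>.\<close>

definition Y where "Y = fls_X_intpow (int v) * fls_compose_power Rt p"

abbreviation ev where "ev \<equiv> puiseux_eval p Y"

lemma Y_power_p: "Y ^ p = fls_compose_power (expand_at x f) p"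
  using p0 by (simp add: Y_def F_eq power_mult_distrib fls_X_intpow_power mult.commute)

lemma Y_nonzero: "Y \<noteq> 0"
  using Rt0 p0 by (simp add: Y_def fls_compose_power_eq_0_iff)

lemma ev_monom: "ev (Polynomial.monom a n) = fls_compose_power a p * Y ^ n"
  by (induction n) (simp_all add: monom_0 monom_Suc)

lemma ev_M: "ev M = 0"
  using p0 by (simp add: M_def puiseux_eval_diff ev_monom Y_power_p)

text \<open>The terms \<open>c\<^sub>k(s^p) Y^k\<close> with \<open>k < p\<close> are supported in distinct residue classes modulo \<open>p\<close>.\<close>

lemma ev_eq_0_imp_eq_0:
  assumes "Polynomial.degree P < p" "ev P = 0"
  shows "P = 0"
proof (rule poly_eqI)
  fix k
  let ?c = "Polynomial.coeff P"
  have term_nth: "(fls_compose_power (?c j) p * Y ^ j) $$ n =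
      (if int p dvd n - int v * int j then (?c j * Rt ^ j) $$ ((n - int v * int j) div int p) else 0)" for j n
  proof -
    have "fls_compose_power (?c j) p * Y ^ j =
        fls_X_intpow (int v * int j) * fls_compose_power (?c j * Rt ^ j) p"
      using p0 by (simp add: Y_def power_mult_distrib fls_X_intpow_power mult_ac)
    also have "\<dots> $$ n = fls_compose_power (?c j * Rt ^ j) p $$ (n - int v * int j)"
      by (simp only: fls_X_intpow_times_conv_shift) simp
    finally show ?thesis
      using p0 by (simp only: fls_nth_compose_power)
  qed
  show "?c k = Polynomial.coeff 0 k"
  proof (cases "k \<le> Polynomial.degree P")
    case True
    have "(?c k * Rt ^ k) $$ i = 0" for i
    proof -
      \<comment> \<open>Exponents congruent to v k modulo \<open>p\<close> occur only in the
        \<open>k\<close>-th summand, since \<open>v\<close> is invertible modulo \<open>p\<close>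
        and distinct indices below \<open>p\<close> are incongruent. Varying \<open>i\<close> reads
        off every coefficient of c_k \<open>Rt\<close>^k.\<close>
      let ?n = "int v * int k + int p * i"
      have other: "(fls_compose_power (?c j) p * Y ^ j) $$ ?n = 0"
        if "j \<le> Polynomial.degree P" "j \<noteq> k" for j
      proof -
        have "\<not> int p dvd ?n - int v * int j"
        proof
          assume "int p dvd ?n - int v * int j"
          then have "int p dvd int v * (int k - int j) + int p * i"
            by (simp add: algebra_simps)
          then have "int p dvd int v * (int k - int j)"
            by (simp add: dvd_add_left_iff)
          moreover have "coprime (int p) (int v)"
            using copr by (simp add: coprime_commute)
          ultimately have "int p dvd int k - int j"
            by (simp add: coprime_dvd_mult_right_iff)
          then show False
            using that True assms(1) dvd_imp_le_int[of "int k - int j" "int p"] by auto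
        qed
        then show ?thesis by (simp add: term_nth)
      qed
      have "0 = ev P $$ ?n" using assms(2) by simp
      also have "\<dots> = (\<Sum>j\<le>Polynomial.degree P. (fls_compose_power (?c j) p * Y ^ j) $$ ?n)"
        using p0 by (simp add: puiseux_eval_sum fls_nth_sum)
      also have "\<dots> = (\<Sum>j\<in>{k}. (fls_compose_power (?c j) p * Y ^ j) $$ ?n)"
        by (rule sum.mono_neutral_right) (use True other in auto)
      also have "\<dots> = (?c k * Rt ^ k) $$ i"
        using p0 by (simp add: term_nth)
      finally show ?thesis by simp
    qed
    then have "?c k * Rt ^ k = 0" by (simp add: fls_eq_iff)
    then show ?thesis using Rt0 by simp
  qed (simp add: coeff_eq_0)
qed

text \<open>The remainder modulo \<open>M\<close> has degree below \<open>p\<close>, so it vanishes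
  as soon as \<open>ev\<close> kills it. Thus \<open>ev\<close> is injective on the quotient, and
  identities between classes can be tested in the field of Laurent series.\<close>

lemma M_dvd_iff: "M dvd P \<longleftrightarrow> ev P = 0"
proof
  assume "M dvd P"
  then show "ev P = 0" by (auto simp: puiseux_eval_mult ev_M)
next
  assume "ev P = 0"
  have deg: "Polynomial.degree M = p"
    using p0 degree_add_eq_left[of "[:- expand_at x f:]" "Polynomial.monom 1 p"]
    unfolding M_def diff_conv_add_uminus by (simp add: degree_monom_eq)
  have "P = P div M * M + P mod M" by (rule div_mult_mod_eq[symmetric])
  then have "ev (P mod M) = 0"
    using \<open>ev P = 0\<close> by (metis add_0 ev_M mult_zero_right puiseux_eval_add puiseux_eval_mult)
  moreover have "Polynomial.degree (P mod M) < p"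
    using degree_mod_less[of M P] deg p0 by fastforce
  ultimately have "P mod M = 0" by (simp add: ev_eq_0_imp_eq_0)
  then show "M dvd P" by (simp add: mod_eq_0_iff_dvd)
qed

section \<open>Arithmetic of residue classes\<close>

abbreviation E where "E \<equiv> local_algebra p f x"
abbreviation cls where "cls \<equiv> local_class p f x"

lemma local_ideal_eq: "local_ideal p f x = {P. M dvd P}"
  by (auto simp: local_ideal_def cgenideal_def ring_of_type_algebra_def M_def mult.commute)

lemma ideal_local_ideal: "ideal (local_ideal p f x) ring_of_type_algebra"
  unfolding local_ideal_def
  by (rule cring.cgenideal_ideal[OF cring_from_type_algebra]) (simp add: ring_of_type_algebra_def)

lemma cls_eq: "cls P = {Q. M dvd Q - P}"
proof -
  have "cls P = {H + P | H. M dvd H}"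
    by (auto simp: local_class_def local_ideal_eq a_r_coset_def r_coset_def ring_of_type_algebra_def)
  also have "\<dots> = {Q. M dvd Q - P}"
    by (auto intro: exI[of _ "_ - P"])
  finally show ?thesis .
qed

lemma cls_eq_iff: "cls P = cls Q \<longleftrightarrow> ev P = ev Q"
  by (auto simp: cls_eq M_dvd_iff puiseux_eval_diff set_eq_iff)

lemma carrier_E: "carrier E = range cls"
  by (auto simp: local_algebra_def local_class_def FactRing_def A_RCOSETS_def' ring_of_type_algebra_def)

lemma cls_carrier [simp]: "cls P \<in> carrier E"
  by (simp add: carrier_E)

lemma cls_mult: "cls P \<otimes>\<^bsub>E\<^esub> cls Q = cls (P * Q)"
  using ideal.rcoset_mult_add[OF ideal_local_ideal, of P Q]
  by (simp add: local_algebra_def local_class_def FactRing_def ring_of_type_algebra_def)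

lemma cls_add: "cls P \<oplus>\<^bsub>E\<^esub> cls Q = cls (P + Q)"
  using abelian_subgroup.a_rcos_sum[OF abelian_subgroupI3[OF ideal.axioms(1)[OF ideal_local_ideal]
      ring.is_abelian_group[OF ring_from_type_algebra]], of P Q]
  by (simp add: local_algebra_def local_class_def FactRing_def ring_of_type_algebra_def)

lemma one_E: "\<one>\<^bsub>E\<^esub> = cls 1"
  by (simp add: local_algebra_def local_class_def FactRing_def ring_of_type_algebra_def)

lemma cring_E: "cring E"
  unfolding local_algebra_def
  by (rule ideal.quotient_is_cring[OF ideal_local_ideal]) (rule cring_from_type_algebra)

lemma cls_pow: "cls P [^]\<^bsub>E\<^esub> (n::nat) = cls (P ^ n)"
proof -
  interpret E: cring E by (rule cring_E)
  show ?thesis by (induction n) (simp_all add: one_E cls_mult mult.commute)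
qed

text \<open>The automorphism \<open>y \<mapsto> c y\<close> for a \<open>p\<close>-th root of unity \<open>c\<close>, on representatives\<close>

definition twist :: "complex \<Rightarrow> complex fls poly \<Rightarrow> complex fls poly" where
  "twist c P = pcompose P [:0, fls_const c:]"

lemma twist_monom: "twist c (Polynomial.monom a n) = Polynomial.monom (fls_const (c ^ n) * a) n"
  by (induction n)
     (simp_all add: twist_def monom_0 monom_Suc pcompose_pCons smult_monom mult.assoc)

lemma M_twist: "c ^ p = 1 \<Longrightarrow> twist c M = M"
  using twist_monom[of c 1 p] by (simp add: M_def twist_def pcompose_diff)

lemma twist_1: "twist c 1 = 1"
  by (simp add: twist_def pcompose_1)

lemma twist_diff: "twist c (P - Q) = twist c P - twist c Q"
  by (simp add: twist_def pcompose_diff)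

lemma twist_add: "twist c (P + Q) = twist c P + twist c Q"
  by (simp add: twist_def pcompose_add)

lemma twist_mult: "twist c (P * Q) = twist c P * twist c Q"
  by (simp add: twist_def pcompose_mult)

lemma twist_twist: "c * d = 1 \<Longrightarrow> twist c (twist d P) = P"
  by (simp add: twist_def pcompose_pCons mult.commute flip: pcompose_assoc)

text \<open>Since \<open>twist c\<close> is multiplicative and fixes \<open>M\<close>, it preserves
  divisibility by \<open>M\<close>; the automorphism is therefore well defined on classes.\<close>

lemma cls_twist_cong:
  assumes "c ^ p = 1" "cls P = cls Q"
  shows "cls (twist c P) = cls (twist c Q)"
proof -
  have "M dvd P - Q"
    using assms(2) by (simp add: cls_eq_iff M_dvd_iff puiseux_eval_diff)
  then have "twist c M dvd twist c (P - Q)"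
    by (auto simp: twist_mult)
  then show ?thesis
    using assms(1) by (simp add: M_twist twist_diff M_dvd_iff puiseux_eval_diff cls_eq_iff)
qed

text \<open>The restriction to the carrier makes the map extensional, as
  \<open>galois_automorphisms\<close> demands. The chosen representative does not matter, by
  \<open>cls_twist_cong\<close>.\<close>

definition gal :: "complex \<Rightarrow> complex fls poly set \<Rightarrow> complex fls poly set" where
  "gal c = (\<lambda>C\<in>carrier E. cls (twist c (SOME P. C = cls P)))"

lemma gal_cls:
  assumes "c ^ p = 1"
  shows "gal c (cls P) = cls (twist c P)"
proof -
  have "cls (SOME Q. cls P = cls Q) = cls P"
    by (rule someI2[of _ P], rule refl, erule sym)
  then have "cls (twist c (SOME Q. cls P = cls Q)) = cls (twist c P)"
    by (rule cls_twist_cong[OF assms])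
  then show ?thesis by (simp only: gal_def restrict_apply' cls_carrier)
qed

lemma gal_iso:
  assumes "c ^ p = 1"
  shows "gal c \<in> ring_iso E E"
proof -
  have "c \<noteq> 0" using assms p0 by (metis power_0_left less_irrefl zero_neq_one)
  then have inv: "c * inverse c = 1" "inverse c * c = 1" by simp_all
  have inv_p: "inverse c ^ p = 1"
    by (simp add: power_inverse assms)
  have "gal c \<in> ring_hom E E"
    by (rule ring_hom_memI)
       (auto simp: carrier_E gal_cls assms cls_mult cls_add one_E twist_mult twist_add twist_1)
  moreover have "bij_betw (gal c) (carrier E) (carrier E)"
    by (rule bij_betw_byWitness[where f' = "gal (inverse c)"])
       (auto simp: carrier_E gal_cls assms inv inv_p twist_twist)
  ultimately show ?thesis by (simp add: ring_iso_def)
qed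

text \<open>The algebra is generated over the base field by the class of y, so an automorphism is
  determined by its value there. Uniqueness is an induction along the Horner form of a
  representative.\<close>

lemma local_galois_eq:
  assumes "c ^ p = 1"
  shows "local_galois p f x c = gal c"
  unfolding local_galois_def
proof (rule the_equality)
  show "gal c \<in> galois_automorphisms E (local_embedding p f x) \<and>
      gal c (local_y p f x) = local_embedding p f x (fls_const c) \<otimes>\<^bsub>E\<^esub> local_y p f x"
    using assms
    by (simp add: galois_automorphisms_def gal_iso local_embedding_def local_y_def gal_cls cls_mult
        twist_def pcompose_pCons)
       (simp add: gal_def)
next
  fix g
  assume g: "g \<in> galois_automorphisms E (local_embedding p f x) \<and>
      g (local_y p f x) = local_embedding p f x (fls_const c) \<otimes>\<^bsub>E\<^esub> local_y p f x"
  then have hom: "g \<in> ring_hom E E" and ext: "g \<in> extensional (carrier E)"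
    and const: "g (cls [:a:]) = cls [:a:]"
    and y: "g (cls [:0, 1:]) = cls [:0, fls_const c:]" for a
    by (auto simp: galois_automorphisms_def ring_iso_def local_embedding_def local_y_def cls_mult)
  have "g (cls P) = cls (twist c P)" for P
  proof (induction P)
    case 0
    show ?case using const[of 0] by (simp add: twist_def)
  next
    case (pCons a P)
    have "g (cls (pCons a P)) = g (cls [:a:] \<oplus>\<^bsub>E\<^esub> (cls [:0, 1:] \<otimes>\<^bsub>E\<^esub> cls P))"
      by (simp add: cls_add cls_mult)
    also have "\<dots> = g (cls [:a:]) \<oplus>\<^bsub>E\<^esub> (g (cls [:0, 1:]) \<otimes>\<^bsub>E\<^esub> g (cls P))"
      using ring_hom_add[OF hom, of "cls [:a:]" "cls ([:0, 1:] * P)"]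
        ring_hom_mult[OF hom, of "cls [:0, 1:]" "cls P"]
      by (simp only: cls_mult cls_carrier)
    also have "\<dots> = cls [:a:] \<oplus>\<^bsub>E\<^esub> (cls [:0, fls_const c:] \<otimes>\<^bsub>E\<^esub> cls (twist c P))"
      by (simp only: const y pCons.IH)
    finally show ?case by (simp add: cls_add cls_mult twist_def pcompose_pCons)
  qed
  moreover have "gal c \<in> extensional (carrier E)"
    by (simp add: gal_def)
  ultimately show "g = gal c"
    using ext by (auto intro!: extensionalityI simp only: carrier_E gal_cls[OF assms])
qed

section \<open>The Kummer pairing of a uniformizer\<close>

lemma root_of_uniformizer:
  assumes z: "is_uniformizer z" and a: "a * v = 1 + p * b"
  obtains k where "k \<noteq> 0" "k ^ p * expand_at x f ^ a = z"
proof -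
  have "z \<noteq> 0" "fls_subdegree z = 1" using z by (auto simp: is_uniformizer_def)
  then obtain R where R: "z = fls_X_intpow 1 * R ^ p" "R \<noteq> 0"
    using fls_factor_nth_power[of z p] p0 by metis
  \<comment> \<open>As z = t R^p and f^a = t^(a v) \<open>Rt\<close>^(a p) with a v = 1 + p b, the
    quotient z / f^a is the \<open>p\<close>-th power of this element. Consequently k y^a is a
    \<open>p\<close>-th root of \<open>z\<close>.\<close>
  define k where "k = fls_X_intpow (- int b) * inverse (Rt ^ a) * R"
  have exps: "- (int p * int b) + int a * int v = 1"
    using arg_cong[OF a, of int] by simp
  have "k ^ p * expand_at x f ^ a =
      (fls_X_intpow (- (int p * int b)) * fls_X_intpow (int a * int v)) * R ^ p *
      (inverse (Rt ^ a) ^ p * (Rt ^ p) ^ a)"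
    unfolding k_def F_eq power_mult_distrib fls_X_intpow_power by (simp only: mult_ac mult_minus_right)
  also have "inverse (Rt ^ a) ^ p * (Rt ^ p) ^ a = 1"
    using Rt0 by (simp add: power_inverse flip: power_mult) (simp add: mult.commute)
  also have "fls_X_intpow (- (int p * int b)) * fls_X_intpow (int a * int v) = (fls_X_intpow 1 :: complex fls)"
    by (simp only: fls_X_intpow_times_fls_X_intpow exps)
  finally have "k ^ p * expand_at x f ^ a = z" using R by simp
  moreover have "k \<noteq> 0" using R Rt0 by (simp add: k_def fls_shift_eq0_iff)
  ultimately show ?thesis using that by blast
qed

text \<open>The automorphism multiplies the root k y^a of \<open>z\<close> by \<open>c ^ a\<close>.
  Under \<open>ev\<close>, any other root differs from it by a root of unity, hence by a constant,
  and constants are fixed; so every root yields the same ratio.\<close>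

lemma kummer_pairing_eq:
  assumes z: "is_uniformizer z" and a: "a * v = 1 + p * b" and c: "c ^ p = 1"
  shows "kummer_pairing p E (local_embedding p f x) (gal c) z = c ^ a"
proof -
  interpret E: cring E by (rule cring_E)
  obtain k where k: "k \<noteq> 0" "k ^ p * expand_at x f ^ a = z"
    using root_of_uniformizer[OF z a] by blast
  have "z \<noteq> 0" using z by (auto simp: is_uniformizer_def)
  define S where "S = Polynomial.monom k a"
  have twist_S: "twist d S = Polynomial.smult (fls_const (d ^ a)) S" for d
    by (simp add: S_def twist_monom smult_monom)
  have ev_S: "ev S ^ p = fls_compose_power z p"
    using p0 Y_power_p
    by (simp add: S_def ev_monom power_mult_distrib flip: k(2) power_mult)
       (simp add: power_mult mult.commute[of a p])
  have ev_S0: "ev S \<noteq> 0"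
    using k(1) p0 Y_nonzero by (simp add: S_def ev_monom fls_compose_power_eq_0_iff)
  \<comment> \<open>The inverse of a root Q of \<open>z\<close> is written down as Q^(p - 1) / z, so
    that \<open>inv\<close> in the pairing denotes a true inverse.\<close>
  have unit: "cls Q \<in> Units E" if "cls Q [^]\<^bsub>E\<^esub> p = cls [:z:]" for Q
  proof -
    obtain m where m: "p = Suc m" using p0 by (cases p) auto
    have "Q * (Q ^ m * [:inverse z:]) = Q ^ p * [:inverse z:]"
      by (simp only: m power_Suc mult.assoc)
    then have "cls Q \<otimes>\<^bsub>E\<^esub> cls (Q ^ m * [:inverse z:]) = (cls Q [^]\<^bsub>E\<^esub> p) \<otimes>\<^bsub>E\<^esub> cls [:inverse z:]"
      by (simp only: cls_mult cls_pow)
    also have "\<dots> = \<one>\<^bsub>E\<^esub>"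
      using that \<open>z \<noteq> 0\<close> by (simp add: cls_mult one_E flip: one_pCons)
    finally show ?thesis
      using E.m_comm[of "cls Q"] by (auto simp: Units_def)
  qed
  have pair: "gal c (cls Q) \<otimes>\<^bsub>E\<^esub> inv\<^bsub>E\<^esub> cls Q = local_embedding p f x (fls_const (c ^ a))"
    if Q: "cls Q [^]\<^bsub>E\<^esub> p = cls [:z:]" for Q
  proof -
    have "ev Q ^ p = fls_compose_power z p"
      using Q p0 by (simp add: cls_pow cls_eq_iff puiseux_eval_power)
    then have "(ev Q / ev S) ^ p = 1"
      using ev_S \<open>z \<noteq> 0\<close> by (simp add: power_divide fls_compose_power_eq_0_iff[OF p0])
    then obtain \<omega> where "ev Q / ev S = fls_const \<omega>"
      using fls_unity_root_is_const p0 by metis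
    then have ev_Q: "ev Q = fls_const \<omega> * ev S"
      using ev_S0 by (simp add: field_simps)
    then have "cls Q = cls (Polynomial.smult (fls_const \<omega>) S)"
      using p0 by (simp add: cls_eq_iff puiseux_eval_smult)
    then have "gal c (cls Q) = cls (twist c (Polynomial.smult (fls_const \<omega>) S))"
      using c by (simp add: gal_cls)
    also have "\<dots> = cls (Polynomial.smult (fls_const (c ^ a)) Q)"
      using p0 ev_Q twist_S[of c]
      by (simp add: cls_eq_iff puiseux_eval_smult twist_def pcompose_smult mult_ac)
    also have "\<dots> = local_embedding p f x (fls_const (c ^ a)) \<otimes>\<^bsub>E\<^esub> cls Q"
      by (simp add: local_embedding_def cls_mult)
    finally show ?thesis
      using unit[OF Q] by (simp add: E.m_assoc local_embedding_def)
  qed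
  \<comment> \<open>An actual root exists, so the universal condition in
    \<open>kummer_pairing\<close> is not vacuous and determines the constant.\<close>
  have S: "cls S [^]\<^bsub>E\<^esub> p = cls [:z:]"
    using p0 ev_S by (simp add: cls_pow cls_eq_iff puiseux_eval_power)
  show ?thesis
    unfolding kummer_pairing_def
  proof (rule the_equality)
    show "c ^ a \<in> carrier (root_of_unity_group p) \<and>
        (\<forall>s\<in>carrier E. s [^]\<^bsub>E\<^esub> p = local_embedding p f x z \<longrightarrow>
          gal c s \<otimes>\<^bsub>E\<^esub> inv\<^bsub>E\<^esub> s = local_embedding p f x (fls_const (c ^ a)))"
      using c pair
      by (auto simp: root_of_unity_group_def carrier_E local_embedding_def power_mult[symmetric] mult.commute[of a p])
         (simp add: power_mult)
  next
    fix d
    assume "d \<in> carrier (root_of_unity_group p) \<and>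
        (\<forall>s\<in>carrier E. s [^]\<^bsub>E\<^esub> p = local_embedding p f x z \<longrightarrow>
          gal c s \<otimes>\<^bsub>E\<^esub> inv\<^bsub>E\<^esub> s = local_embedding p f x (fls_const d))"
    then have "local_embedding p f x (fls_const d) = local_embedding p f x (fls_const (c ^ a))"
      using S pair[OF S] by (auto simp: local_embedding_def)
    then have "fls_const d = fls_const (c ^ a)"
      using p0 by (simp add: local_embedding_def cls_eq_iff)
    then show "d = c ^ a" by (metis fls_const_nth)
  qed
qed

end

section \<open>Discrete logarithms and the algebraic rotation number\<close>

lemma exp_root_unity_power:
  "exp (2 * of_real pi * \<i> / of_nat p) ^ k = exp (2 * of_real pi * \<i> * of_nat k / of_nat p)"
  by (simp add: exp_of_nat_mult[symmetric] mult_ac)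

lemma exp_root_unity_power_inj:
  assumes "exp (2 * of_real pi * \<i> / of_nat p) ^ k = exp (2 * of_real pi * \<i> / of_nat p) ^ l"
    "k < p" "l < p"
  shows "k = l"
  using bij_betw_roots_unity[of p] assms
  unfolding exp_root_unity_power by (auto simp: bij_betw_def inj_on_def)

lemma carrier_residue_ring: "0 < p \<Longrightarrow> carrier (residue_ring (int p)) = int ` {..<p}"
  by (auto simp: residue_ring_def image_iff intro!: bexI[of _ "nat _"])

lemma discrete_log_eq:
  assumes "a < p" and \<zeta>: "\<zeta> = exp (2 * of_real pi * \<i> / of_nat p)"
  shows "discrete_log p \<zeta> (\<zeta> ^ a) = int a"
  unfolding discrete_log_def
proof (rule the_equality)
  show "int a \<in> carrier (residue_ring (int p)) \<and> \<zeta> powi int a = \<zeta> ^ a"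
    using assms(1) by (simp add: carrier_residue_ring)
next
  fix b
  assume "b \<in> carrier (residue_ring (int p)) \<and> \<zeta> powi b = \<zeta> ^ a"
  then obtain k where "b = int k" "k < p" "\<zeta> ^ k = \<zeta> ^ a"
    using assms(1) by (auto simp: carrier_residue_ring)
  then show "b = int a"
    using exp_root_unity_power_inj assms by metis
qed

text \<open>The expansion of the cofactor \<open>h\<close> has constant coefficient
  \<open>poly h s\<close>, which is nonzero, so it has a \<open>p\<close>-th root; that root is
  \<open>Rt\<close>.\<close>

lemma local_superelliptic_exists:
  assumes "0 < p" "coprime v p" and f: "f = [:- s, 1:] ^ v * h" and h: "poly h s \<noteq> 0"
  obtains Rt where "local_superelliptic p v f s Rt"
proof -
  define H where "H = fps_of_poly (pcompose h [:s, 1:])"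
  have "pcompose (q ^ n) w = pcompose q w ^ n" for q w :: "complex poly" and n
    by (induction n) (simp_all add: pcompose_1 pcompose_mult)
  then have "expand_at s f = fps_to_fls (fps_X ^ v * H)"
    by (simp add: expand_at_def f H_def pcompose_mult pcompose_pCons fps_of_poly_mult fps_of_poly_power)
  moreover have "fps_nth H 0 \<noteq> 0"
    using h by (simp add: H_def)
  then obtain w where "w ^ p = H" using fps_nth_root_exists[OF assms(1)] by blast
  ultimately have "expand_at s f = fls_X_intpow (int v) * fps_to_fls w ^ p"
    by (auto simp: fls_times_fps_to_fls fps_to_fls_power fls_X_power_conv_shift_1)
  moreover have "fps_to_fls w \<noteq> 0"
    using \<open>w ^ p = H\<close> \<open>fps_nth H 0 \<noteq> 0\<close> assms(1) by (auto simp: power_0_left)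
  ultimately show ?thesis
    using that[of "fps_to_fls w"] assms(1,2) by (simp add: local_superelliptic_def)
qed

lemma algebraic_rotation_eq:
  assumes "0 < p" and f: "f = [:- s, 1:] ^ v * h" "poly h s \<noteq> 0"
    and a: "a < p" "a * v mod p = 1" and "is_uniformizer z"
    and \<zeta>: "\<zeta> = exp (2 * of_real pi * \<i> / of_nat p)"
  shows "algebraic_rotation p f \<zeta> \<zeta> s z = int a"
proof -
  have av: "a * v = 1 + p * (a * v div p)"
    using mult_div_mod_eq[of p "a * v"] a by simp
  \<comment> \<open>A common divisor of \<open>v\<close> and \<open>p\<close> divides both terms of
    the relation \<open>av\<close>, hence their difference 1.\<close>
  have "coprime v p"
  proof (rule coprimeI)
    fix d assume "d dvd v" "d dvd p"
    then have "d dvd a * v" "d dvd p * (a * v div p)" by auto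
    then show "d dvd 1" using av by (metis dvd_add_left_iff)
  qed
  then obtain Rt where "local_superelliptic p v f s Rt"
    using local_superelliptic_exists[OF assms(1) _ f] by blast
  then interpret local_superelliptic p v f s Rt .
  have "\<zeta> ^ p = 1"
    using assms(1) by (simp add: \<zeta> exp_root_unity_power)
  then show ?thesis
    unfolding algebraic_rotation_def
    using kummer_pairing_eq[OF assms(6) av] discrete_log_eq[OF a(1) \<zeta>] by (simp add: local_galois_eq)
qed

unbundle no Formal_Power_Series.fps_syntax

subsection \<open>Orders of vanishing and multipliers in one variable\<close>

text \<open>Because \<open>f z0 = 0\<close>, constancy on a ball would make \<open>f\<close> vanish
  near \<open>z0\<close>; the last hypothesis is thus exactly what gives the zero a finite
  order.\<close>

lemma holomorphic_zero_factor:
  fixes f :: "complex \<Rightarrow> complex"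
  assumes "f holomorphic_on D" "open D" "z0 \<in> D" "f z0 = 0"
    and "\<not> (\<forall>\<^sub>F z in nhds z0. f z = 0)"
  obtains g r n where "0 < n" "0 < r" "ball z0 r \<subseteq> D" "g holomorphic_on ball z0 r"
    "\<And>z. z \<in> ball z0 r \<Longrightarrow> f z = (z - z0) ^ n * g z" "\<And>z. z \<in> ball z0 r \<Longrightarrow> g z \<noteq> 0"
proof -
  obtain r0 where r0: "0 < r0" "ball z0 r0 \<subseteq> D"
    using assms(2,3) open_contains_ball by blast
  have "\<not> f constant_on ball z0 r0"
  proof
    assume "f constant_on ball z0 r0"
    then have "\<forall>z\<in>ball z0 r0. f z = 0"
      using assms(4) r0(1) by (metis centre_in_ball constant_on_def)
    then have "\<forall>\<^sub>F z in nhds z0. f z = 0"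
      using r0(1) eventually_nhds_in_open[of "ball z0 r0" z0] by (auto elim: eventually_mono)
    then show False using assms(5) by simp
  qed
  then show ?thesis
    using holomorphic_factor_zero_nonconstant[of f "ball z0 r0" z0] assms(1,4) r0 that
    by (metis centre_in_ball connected_ball holomorphic_on_subset open_ball subset_trans)
qed

text \<open>On the convex ball a nonvanishing holomorphic function has a logarithm; dividing it by
  \<open>n\<close> and exponentiating gives the root.\<close>

lemma holomorphic_nth_root_on_ball:
  fixes g :: "complex \<Rightarrow> complex"
  assumes "0 < r" "g holomorphic_on ball z0 r" "\<And>z. z \<in> ball z0 r \<Longrightarrow> g z \<noteq> 0" "0 < n"
  obtains h where "h holomorphic_on ball z0 r" "\<And>z. z \<in> ball z0 r \<Longrightarrow> h z ^ n = g z"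
proof -
  obtain k where k: "k holomorphic_on ball z0 r" "\<And>z. z \<in> ball z0 r \<Longrightarrow> exp (k z) = g z"
    using holomorphic_logarithm_exists[OF convex_ball open_ball assms(2,3) centre_in_ball[THEN iffD2, OF assms(1)]]
    by blast
  show ?thesis
  proof
    show "(\<lambda>z. exp (k z / of_nat n)) holomorphic_on ball z0 r"
      using k(1) assms(4) by (auto intro!: holomorphic_intros)
    show "exp (k z / of_nat n) ^ n = g z" if "z \<in> ball z0 r" for z
      using that k(2) assms(4) by (simp add: exp_of_nat_mult[symmetric])
  qed
qed

text \<open>Near \<open>z0\<close>, \<open>f\<close> is the \<open>n\<close>-th power of an open map vanishing at \<open>z0\<close>.\<close>

lemma nearby_preimages:
  fixes f g :: "complex \<Rightarrow> complex"
  assumes n: "0 < n" and r: "0 < r" and g: "g holomorphic_on ball z0 r"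
    and f: "\<And>z. z \<in> ball z0 r \<Longrightarrow> f z = (z - z0) ^ n * g z"
    and nz: "\<And>z. z \<in> ball z0 r \<Longrightarrow> g z \<noteq> 0"
    and W: "open W" "z0 \<in> W"
  obtains \<epsilon> where "0 < \<epsilon>"
    "\<And>\<delta>. \<delta> \<noteq> 0 \<Longrightarrow> norm \<delta> < \<epsilon> \<Longrightarrow> \<exists>T\<subseteq>W. finite T \<and> card T = n \<and> (\<forall>t\<in>T. f t = \<delta>)"
proof -
  obtain h where h: "h holomorphic_on ball z0 r" "\<And>z. z \<in> ball z0 r \<Longrightarrow> h z ^ n = g z"
    using holomorphic_nth_root_on_ball[OF r g nz n] by blast
  \<comment> \<open>Here \<open>\<psi> ^ n = f\<close> on the ball, so solving f = \<delta> amounts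
    to solving \<psi> = \<omega> for the \<open>n\<close>-th roots \<omega> of \<delta>.\<close>
  define \<psi> where "\<psi> z = (z - z0) * h z" for z
  have \<psi>: "\<psi> holomorphic_on ball z0 r"
    unfolding \<psi>_def using h(1) by (auto intro!: holomorphic_intros)
  have "\<not> \<psi> constant_on ball z0 r"
  proof
    assume "\<psi> constant_on ball z0 r"
    then have 0: "\<forall>z\<in>ball z0 r. \<psi> z = 0"
      using r by (metis \<psi>_def centre_in_ball constant_on_def diff_self mult_zero_left)
    have mem: "z0 + of_real (r / 2) \<in> ball z0 r" using r by (simp add: dist_norm)
    then have "\<psi> (z0 + of_real (r / 2)) = 0" using 0 by blast
    then have "h (z0 + of_real (r / 2)) = 0" using r by (simp add: \<psi>_def)
    then show False using h(2)[OF mem] nz[OF mem] n by (simp add: power_0_left)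
  qed
  define V where "V = ball z0 r \<inter> W"
  have "open (\<psi> ` V)"
    using open_mapping_thm[OF \<psi> open_ball connected_ball _ _ \<open>\<not> _\<close>, of V] W
    by (auto simp: V_def)
  moreover have "0 \<in> \<psi> ` V"
    using r W by (auto simp: \<psi>_def V_def image_iff intro!: bexI[of _ z0])
  ultimately obtain \<eta> where \<eta>: "0 < \<eta>" "ball 0 \<eta> \<subseteq> \<psi> ` V"
    using open_contains_ball by blast
  show ?thesis
  proof
    \<comment> \<open>For a \<delta> of norm below this bound all \<open>n\<close>-th roots have
      norm below \<eta>, hence lie in the open image of \<psi>.\<close>
    show "0 < \<eta> ^ n" using \<eta>(1) by simp
    fix \<delta> :: complex assume \<delta>: "\<delta> \<noteq> 0" "norm \<delta> < \<eta> ^ n"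
    define \<Omega> where "\<Omega> = {\<omega>. \<omega> ^ n = \<delta>}"
    have \<Omega>: "\<Omega> \<subseteq> \<psi> ` V"
    proof
      fix \<omega> assume "\<omega> \<in> \<Omega>"
      then have "norm \<omega> ^ n < \<eta> ^ n" using \<delta>(2) by (auto simp: \<Omega>_def simp flip: norm_power)
      then have "norm \<omega> < \<eta>" using \<eta>(1) by (meson less_imp_le power_less_imp_less_base)
      then show "\<omega> \<in> \<psi> ` V" using \<eta>(2) by (auto simp: subset_iff)
    qed
    \<comment> \<open>One preimage is chosen for each root; distinct roots have distinct preimages,
      which gives exactly \<open>n\<close> points.\<close>
    let ?T = "inv_into V \<psi> ` \<Omega>"
    have "?T \<subseteq> V" using \<Omega> by (auto intro: inv_into_into)
    moreover have "card ?T = n"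
      using card_nth_roots[OF \<delta>(1) n] inj_on_inv_into[OF \<Omega>] by (simp add: card_image \<Omega>_def)
    moreover have "finite ?T"
      using finite_nth_roots[OF n] by (simp add: \<Omega>_def)
    moreover have "f t = \<delta>" if t: "t \<in> ?T" for t
    proof -
      obtain \<omega> where "t = inv_into V \<psi> \<omega>" "\<omega> \<in> \<Omega>" using t by (rule imageE)
      then have "\<psi> t = \<omega>" "t \<in> V" using \<Omega> by (auto simp: f_inv_into_f inv_into_into subset_iff)
      then show ?thesis
        using \<open>\<omega> \<in> \<Omega>\<close> f[of t] h(2)[of t] by (auto simp: \<psi>_def \<Omega>_def V_def power_mult_distrib)
    qed
    ultimately show "\<exists>T\<subseteq>W. finite T \<and> card T = n \<and> (\<forall>t\<in>T. f t = \<delta>)"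
      using V_def by (intro exI[of _ ?T] conjI ballI) auto
  qed
qed

text \<open>If i < j, cancelling (z - z0)^i and letting z tend to \<open>z0\<close> would give g z0
  = 0.\<close>

lemma order_of_vanishing_le:
  fixes g h :: "complex \<Rightarrow> complex"
  assumes "isCont g z0" "isCont h z0" "g z0 \<noteq> 0"
    and "\<forall>\<^sub>F z in at z0. (z - z0) ^ i * g z = (z - z0) ^ j * h z"
  shows "j \<le> i"
proof (rule ccontr)
  assume "\<not> j \<le> i"
  then have ij: "j = i + (j - i)" "0 < j - i" by auto
  have "\<forall>\<^sub>F z in at z0. g z = (z - z0) ^ (j - i) * h z"
    using assms(4) eventually_neq_at_within[of z0 z0 UNIV]
  proof eventually_elim
    case (elim z)
    have "(z - z0) ^ i * g z = (z - z0) ^ i * ((z - z0) ^ (j - i) * h z)"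
      using elim(1) ij(1) by (metis mult.assoc power_add)
    then show ?case using elim(2) by simp
  qed
  moreover have "((\<lambda>z. (z - z0) ^ (j - i) * h z) \<longlongrightarrow> (z0 - z0) ^ (j - i) * h z0) (at z0)"
    by (intro tendsto_mult tendsto_power tendsto_diff tendsto_ident_at tendsto_const)
       (use assms(2) in \<open>simp add: isCont_def\<close>)
  ultimately have "(g \<longlongrightarrow> (z0 - z0) ^ (j - i) * h z0) (at z0)"
    by (rule tendsto_cong[THEN iffD2])
  then have "(g \<longlongrightarrow> 0) (at z0)"
    using ij(2) by (simp add: power_0_left)
  then show False
    using assms(1,3) tendsto_unique[of "at z0" g] by (auto simp: isCont_def)
qed

lemma order_of_vanishing_unique:
  fixes g h :: "complex \<Rightarrow> complex"
  assumes "isCont g z0" "isCont h z0" "g z0 \<noteq> 0" "h z0 \<noteq> 0"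
    and "\<forall>\<^sub>F z in at z0. (z - z0) ^ i * g z = (z - z0) ^ j * h z"
  shows "i = j"
proof (rule antisym)
  show "j \<le> i" by (rule order_of_vanishing_le) fact+
  have "\<forall>\<^sub>F z in at z0. (z - z0) ^ j * h z = (z - z0) ^ i * g z"
    using assms(5) by eventually_elim simp
  then show "i \<le> j" using assms order_of_vanishing_le by blast
qed

text \<open>Compare leading coefficients at the fixed point on both sides of \<open>f \<circ> T = c f\<close>.\<close>

lemma multiplier_power_eq:
  fixes f h T :: "complex \<Rightarrow> complex"
  assumes f: "\<forall>\<^sub>F t in nhds t0. f t = (t - t0) ^ n * h t" and h: "isCont h t0" "h t0 \<noteq> 0"
    and T: "(T has_field_derivative l) (at t0)" "T t0 = t0"
    and eq: "\<forall>\<^sub>F t in nhds t0. f (T t) = c * f t"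
  shows "l ^ n = c"
proof -
  have "isCont T t0" using T(1) DERIV_isCont by blast
  then have lim: "filterlim T (nhds t0) (nhds t0)"
    using T(2) tendsto_at_iff_tendsto_nhds[of T t0] by (simp add: isCont_def)
  have q: "((\<lambda>t. (T t - t0) / (t - t0)) \<longlongrightarrow> l) (at t0)"
    using T by (simp add: has_field_derivative_iff)
  have "isCont (\<lambda>t. h (T t)) t0"
    using \<open>isCont T t0\<close> h(1) T(2) by (simp add: isCont_o2)
  then have "((\<lambda>t. ((T t - t0) / (t - t0)) ^ n * h (T t)) \<longlongrightarrow> l ^ n * h t0) (at t0)"
    using q T(2) by (intro tendsto_mult tendsto_power) (simp_all add: isCont_def)
  moreover have ev: "\<forall>\<^sub>F t in at t0. ((T t - t0) / (t - t0)) ^ n * h (T t) = c * h t"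
    using eq[THEN eventually_nhds_conv_at[THEN iffD1, THEN conjunct1]]
      f[THEN eventually_nhds_conv_at[THEN iffD1, THEN conjunct1]]
      eventually_compose_filterlim[OF f lim, THEN eventually_nhds_conv_at[THEN iffD1, THEN conjunct1]]
      eventually_neq_at_within[of t0 t0 UNIV]
    by eventually_elim (simp add: power_divide field_simps)
  ultimately have "((\<lambda>t. c * h t) \<longlongrightarrow> l ^ n * h t0) (at t0)"
    using tendsto_cong[OF ev] by simp
  moreover have "((\<lambda>t. c * h t) \<longlongrightarrow> c * h t0) (at t0)"
    using h(1) by (intro tendsto_mult tendsto_const) (simp add: isCont_def)
  ultimately have "l ^ n * h t0 = c * h t0"
    by (rule tendsto_unique[OF trivial_limit_at])
  then show ?thesis using h(2) by simp
qed

section \<open>Linear approximation at a fixed point\<close>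

lemma linear_approximation_bigo:
  fixes g :: "complex \<Rightarrow> complex"
  assumes "g holomorphic_on D" "open D" "0 \<in> D" "g 0 = 0" "(g has_field_derivative l) (at 0)"
  shows "(\<lambda>t. g t - l * t) \<in> O[at 0](\<lambda>t. t ^ 2)"
proof -
  \<comment> \<open>The difference quotient extends holomorphically across 0. Its own difference
    quotient there is (g t - l t) / t^2, which therefore has a limit.\<close>
  define q where "q z = (if z = 0 then deriv g 0 else (g z - g 0) / (z - 0))" for z
  have "q holomorphic_on D"
    unfolding q_def by (rule pole_lemma_open[OF assms(1,2)])
  then have "(q has_field_derivative deriv q 0) (at 0)"
    using assms(2,3) holomorphic_derivI by blast
  then have "((\<lambda>t. (q t - q 0) / (t - 0)) \<longlongrightarrow> deriv q 0) (at 0)"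
    by (simp add: has_field_derivative_iff)
  moreover have "\<forall>\<^sub>F t in at 0. (q t - q 0) / (t - 0) = (g t - l * t) / t ^ 2"
    using eventually_neq_at_within[of 0 0 UNIV] DERIV_imp_deriv[OF assms(5)] assms(4)
    by (auto simp: q_def field_simps power2_eq_square elim!: eventually_mono)
  ultimately have "((\<lambda>t. (g t - l * t) / t ^ 2) \<longlongrightarrow> deriv q 0) (at 0)"
    using tendsto_cong by force
  then show ?thesis
    by (rule bigoI_tendsto) (use eventually_neq_at_within[of 0 0 UNIV] in \<open>auto elim: eventually_mono\<close>)
qed

text \<open>Subtracting the estimates gives (b - a) t = O(t^2); dividing by t and letting t tend to
  0 leaves b - a = 0.\<close>

lemma linear_approximation_unique:
  fixes g :: "complex \<Rightarrow> complex"
  assumes "(\<lambda>t. g t - a * t) \<in> O[at 0](\<lambda>t. t ^ 2)" "(\<lambda>t. g t - b * t) \<in> O[at 0](\<lambda>t. t ^ 2)"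
  shows "a = b"
proof -
  have "(\<lambda>t. (g t - a * t) - (g t - b * t)) \<in> O[at 0](\<lambda>t. t ^ 2)"
    using assms by (rule sum_in_bigo(2))
  then obtain C where "\<forall>\<^sub>F t in at 0. norm ((g t - a * t) - (g t - b * t)) \<le> C * norm (t ^ 2)"
    by (rule landau_o.bigE)
  then have "\<forall>\<^sub>F t in at (0::complex). norm (b - a) \<le> C * norm t"
    using eventually_neq_at_within[of 0 0 UNIV]
  proof eventually_elim
    case (elim t)
    have "norm t * norm (b - a) = norm ((g t - a * t) - (g t - b * t))"
      by (simp add: algebra_simps flip: norm_mult)
    also have "\<dots> \<le> norm t * (C * norm t)"
      using elim(1) by (simp add: norm_mult power2_eq_square mult_ac)
    finally show ?case using elim(2) by simp
  qed
  moreover have "((\<lambda>t. C * norm t) \<longlongrightarrow> C * norm (0::complex)) (at (0::complex))"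
    by (intro tendsto_mult tendsto_const tendsto_norm tendsto_ident_at)
  ultimately have "norm (b - a) \<le> C * norm (0::complex)"
    using tendsto_lowerbound[OF _ _ trivial_limit_at] by blast
  then show ?thesis by simp
qed

lemma tendsto_0_if_power_tendsto_0:
  fixes g :: "'a \<Rightarrow> complex"
  assumes "((\<lambda>t. g t ^ n) \<longlongrightarrow> 0) F" "0 < n"
  shows "(g \<longlongrightarrow> 0) F"
proof -
  have "((\<lambda>t. root n (norm (g t ^ n))) \<longlongrightarrow> root n (norm (0::complex))) F"
    by (intro tendsto_real_root tendsto_norm assms(1))
  then have "((\<lambda>t. norm (g t)) \<longlongrightarrow> 0) F"
    using assms(2) by (simp add: norm_power real_root_power_cancel)
  then show ?thesis by (simp add: tendsto_norm_zero_iff)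
qed

text \<open>If \<beta> vanished near \<open>t0\<close>, the equation would force \<alpha> = s there,
  so both orders are finite. The factor \<open>h\<close> contributes nothing to the order, whence n
  p = e v, and coprimality moves \<open>p\<close> into \<open>e\<close>.\<close>

lemma order_relation:
  fixes \<alpha> \<beta> :: "complex \<Rightarrow> complex"
  assumes D: "open D" "t0 \<in> D" and hol: "\<alpha> holomorphic_on D" "\<beta> holomorphic_on D"
    and at_t0: "\<alpha> t0 = s" "\<beta> t0 = 0" and h: "poly h s \<noteq> 0"
    and eq: "\<And>t. t \<in> D \<Longrightarrow> \<beta> t ^ p = (\<alpha> t - s) ^ v * poly h (\<alpha> t)"
    and nonconst: "\<not> (\<forall>\<^sub>F t in nhds t0. \<alpha> t = s)" and p: "0 < p" and v: "0 < v" "coprime p v"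
  obtains r e n g k where "0 < r" "ball t0 r \<subseteq> D" "0 < e" "p dvd e" "n * p = e * v"
    "g holomorphic_on ball t0 r" "k holomorphic_on ball t0 r"
    "\<And>t. t \<in> ball t0 r \<Longrightarrow> \<alpha> t = s + (t - t0) ^ e * g t \<and> g t \<noteq> 0"
    "\<And>t. t \<in> ball t0 r \<Longrightarrow> \<beta> t = (t - t0) ^ n * k t \<and> k t \<noteq> 0"
proof -
  have hol': "(\<lambda>t. \<alpha> t - s) holomorphic_on D" using hol(1) by (intro holomorphic_intros)
  have nonconst': "\<alpha> t0 - s = 0" "\<not> (\<forall>\<^sub>F t in nhds t0. \<alpha> t - s = 0)"
    using at_t0(1) nonconst by simp_all
  obtain g r1 e where g: "0 < e" "0 < r1" "ball t0 r1 \<subseteq> D" "g holomorphic_on ball t0 r1"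
      "\<And>t. t \<in> ball t0 r1 \<Longrightarrow> \<alpha> t - s = (t - t0) ^ e * g t" "\<And>t. t \<in> ball t0 r1 \<Longrightarrow> g t \<noteq> 0"
    by (rule holomorphic_zero_factor[OF hol' D nonconst']) blast
  have "isCont \<alpha> t0"
    using hol(1) D holomorphic_on_imp_continuous_on continuous_on_eq_continuous_at by blast
  then have cont_h: "isCont (\<lambda>t. poly h (\<alpha> t)) t0"
    by (intro isCont_o2[OF _ poly_isCont])
  have "\<forall>\<^sub>F t in nhds t0. poly h (\<alpha> t) \<noteq> 0"
    using cont_h h at_t0(1) tendsto_imp_eventually_ne[of "\<lambda>t. poly h (\<alpha> t)" "poly h s" "nhds t0" 0]
      tendsto_at_iff_tendsto_nhds[of "\<lambda>t. poly h (\<alpha> t)" t0]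
    by (simp add: isCont_def)
  moreover have D_ev: "\<forall>\<^sub>F t in nhds t0. t \<in> D"
    using D by (rule eventually_nhds_in_open)
  ultimately have "\<not> (\<forall>\<^sub>F t in nhds t0. \<beta> t = 0)"
  proof (rule_tac notI)
    assume "\<forall>\<^sub>F t in nhds t0. \<beta> t = 0" "\<forall>\<^sub>F t in nhds t0. t \<in> D" "\<forall>\<^sub>F t in nhds t0. poly h (\<alpha> t) \<noteq> 0"
    then have "\<forall>\<^sub>F t in nhds t0. \<alpha> t = s"
    proof eventually_elim
      case (elim t)
      then show ?case using eq[of t] p by (simp add: power_0_left)
    qed
    then show False using nonconst by simp
  qed
  then obtain k r2 n where k: "0 < n" "0 < r2" "ball t0 r2 \<subseteq> D" "k holomorphic_on ball t0 r2"
      "\<And>t. t \<in> ball t0 r2 \<Longrightarrow> \<beta> t = (t - t0) ^ n * k t" "\<And>t. t \<in> ball t0 r2 \<Longrightarrow> k t \<noteq> 0"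
    using holomorphic_zero_factor[of \<beta> D t0] D at_t0(2) hol(2) by metis
  define r where "r = min r1 r2"
  have r: "0 < r" "ball t0 r \<subseteq> ball t0 r1" "ball t0 r \<subseteq> ball t0 r2"
    using g(2) k(2) by (auto simp: r_def)
  have t0: "t0 \<in> ball t0 r1" "t0 \<in> ball t0 r2" using g(2) k(2) by simp_all
  have "isCont g t0" "isCont k t0"
    using g(4) k(4) t0 holomorphic_on_imp_continuous_on continuous_on_eq_continuous_at open_ball by blast+
  then have "isCont (\<lambda>t. k t ^ p) t0" "isCont (\<lambda>t. g t ^ v * poly h (\<alpha> t)) t0"
    using cont_h by (auto intro!: continuous_intros)
  moreover have "k t0 ^ p \<noteq> 0" "g t0 ^ v * poly h (\<alpha> t0) \<noteq> 0"
    using g(6) k(6) t0 h at_t0(1) by simp_all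
  moreover have "\<forall>\<^sub>F t in at t0. t \<in> ball t0 r"
    by (rule eventually_at_in_open') (use r(1) in auto)
  then have "\<forall>\<^sub>F t in at t0. (t - t0) ^ (n * p) * k t ^ p = (t - t0) ^ (e * v) * (g t ^ v * poly h (\<alpha> t))"
  proof eventually_elim
    case (elim t)
    then have "t \<in> ball t0 r1" "t \<in> ball t0 r2" using r by blast+
    then show ?case using eq[of t] g(3) g(5)[of t] k(5)[of t]
      by (auto simp: power_mult power_mult_distrib)
  qed
  ultimately have np: "n * p = e * v"
    by (rule order_of_vanishing_unique)
  then have "p dvd e * v" by (metis dvd_triv_right)
  then have "p dvd e" using v(2) by (simp add: coprime_dvd_mult_left_iff)
  show ?thesis
  proof (rule that[of r e n g k])
    show "\<alpha> t = s + (t - t0) ^ e * g t \<and> g t \<noteq> 0" if "t \<in> ball t0 r" for t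
      using g(5)[of t] g(6)[of t] that r(2) by (auto simp: algebra_simps)
    show "\<beta> t = (t - t0) ^ n * k t \<and> k t \<noteq> 0" if "t \<in> ball t0 r" for t
      using k(5)[of t] k(6)[of t] that r(3) by auto
    show "g holomorphic_on ball t0 r" "k holomorphic_on ball t0 r"
      using g(4) k(4) r holomorphic_on_subset by blast+
  qed (use r g(1,3) \<open>p dvd e\<close> np in auto)
qed

subsection \<open>Points of the projective curve\<close>

lemma hpoint_eqD: "hpoint a = hpoint b \<Longrightarrow> \<exists>c. a = c *s b"
proof -
  assume "hpoint a = hpoint b"
  moreover have "a \<in> hpoint a" by (auto simp: hpoint_def intro: range_eqI[of _ _ 1])
  ultimately show ?thesis by (auto simp: hpoint_def)
qed

lemma hpoint_scale:
  assumes "c \<noteq> 0"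
  shows "hpoint (c *s a) = hpoint a"
proof -
  have eq: "d *s a = (d / c) *s (c *s a)" for d
    using assms by simp
  show ?thesis
  proof
    show "hpoint (c *s a) \<subseteq> hpoint a" by (auto simp: hpoint_def)
    show "hpoint a \<subseteq> hpoint (c *s a)"
      unfolding hpoint_def by (rule image_subsetI, subst eq) blast
  qed
qed

lemma hpoint_affine3_eq_iff:
  "hpoint (vector [a, b, 1] :: complex ^ 3) = hpoint (vector [a', b', 1]) \<longleftrightarrow> a = a' \<and> b = b'"
proof
  assume "hpoint (vector [a, b, 1] :: complex ^ 3) = hpoint (vector [a', b', 1])"
  from hpoint_eqD[OF this] show "a = a' \<and> b = b'"
    by (auto simp: vec_eq_iff forall_3)
qed simp

lemma hpoint_affine3:
  fixes F :: "complex ^ 3"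
  assumes "F $ 3 \<noteq> 0"
  shows "hpoint F = hpoint (vector [F $ 1 / F $ 3, F $ 2 / F $ 3, 1])"
proof -
  have "F = F $ 3 *s vector [F $ 1 / F $ 3, F $ 2 / F $ 3, 1]"
    using assms by (simp add: vec_eq_iff forall_3)
  then show ?thesis using hpoint_scale[OF assms] by metis
qed

lemma hpoint_affine2D:
  fixes G :: "complex ^ 2"
  assumes "hpoint G = hpoint (vector [a, 1])" "G \<noteq> 0"
  shows "G $ 2 \<noteq> 0 \<and> G $ 1 / G $ 2 = a"
proof -
  obtain c where c: "G = c *s vector [a, 1]" using hpoint_eqD[OF assms(1)] by blast
  then have "c \<noteq> 0" using assms(2) by auto
  then show ?thesis by (simp add: c)
qed

text \<open>The representative that satisfies the equation is a nonzero multiple c of the affine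
  one. Since N is the maximum of \<open>p\<close> and the degree, no subtraction of exponents is
  truncated, and homogeneity lets c^N cancel.\<close>

lemma mem_projective_completion_affine:
  assumes "hpoint (vector [a, b, 1]) \<in> projective_completion p f"
  shows "b ^ p = poly f a"
proof -
  define N where "N = max p (Polynomial.degree f)"
  obtain e :: "complex ^ 3" where e: "e \<noteq> 0" "hpoint (vector [a, b, 1]) = hpoint e"
    "(e $ 2) ^ p * (e $ 3) ^ (N - p) =
      (\<Sum>k\<le>Polynomial.degree f. Polynomial.coeff f k * (e $ 1) ^ k * (e $ 3) ^ (N - k))"
    using assms by (auto simp: projective_completion_def Let_def N_def)
  obtain c where c: "e = c *s vector [a, b, 1]" using hpoint_eqD[OF e(2)[symmetric]] by blast
  then have "c \<noteq> 0" using e(1) by auto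
  have "c ^ N * b ^ p = (c * b) ^ p * c ^ (N - p)"
    by (simp add: N_def power_mult_distrib mult_ac flip: power_add)
  also have "\<dots> = (\<Sum>k\<le>Polynomial.degree f. Polynomial.coeff f k * (c * a) ^ k * c ^ (N - k))"
    using e(3) by (simp add: c)
  also have "\<dots> = (\<Sum>k\<le>Polynomial.degree f. c ^ N * (Polynomial.coeff f k * a ^ k))"
    by (intro sum.cong refl) (auto simp: N_def power_mult_distrib mult_ac simp flip: power_add)
  also have "\<dots> = c ^ N * poly f a"
    by (simp add: poly_altdef sum_distrib_left)
  finally show ?thesis using \<open>c \<noteq> 0\<close> by simp
qed

lemma affine_mem_projective_completion:
  assumes "b ^ p = poly f a"
  shows "hpoint (vector [a, b, 1]) \<in> projective_completion p f"
proof -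
  have "(vector [a, b, 1] :: complex ^ 3) $ 3 \<noteq> (0 :: complex ^ 3) $ 3" by simp
  then have "(vector [a, b, 1] :: complex ^ 3) \<noteq> 0" by metis
  then show ?thesis
    unfolding projective_completion_def Let_def
    by (intro imageI) (use assms in \<open>simp add: poly_altdef\<close>)
qed

text \<open>On z = 0 only the terms of top degree survive. With x = 0 this leaves [0 : 1 : 0];
  otherwise x scales to 1, a degree above \<open>p\<close> would kill the leading coefficient, and y
  satisfies a pure equation of degree \<open>p\<close>.\<close>

lemma finite_points_at_infinity:
  assumes "0 < p" "f \<noteq> 0"
  shows "finite (projective_completion p f \<inter> {hpoint e | e. e \<noteq> 0 \<and> e $ 3 = 0})"
proof (rule finite_subset)
  let ?B = "{b. b ^ p = Polynomial.coeff f p}"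
  show "finite (insert (hpoint (vector [0, 1, 0])) ((\<lambda>b. hpoint (vector [1, b, 0])) ` ?B)
      :: (complex ^ 3) set set)"
    using finite_nth_roots[OF assms(1)] by simp
  show "projective_completion p f \<inter> {hpoint e | e. e \<noteq> 0 \<and> e $ 3 = 0} \<subseteq>
      insert (hpoint (vector [0, 1, 0])) ((\<lambda>b. hpoint (vector [1, b, 0])) ` ?B)"
  proof
    fix h assume h: "h \<in> projective_completion p f \<inter> {hpoint e | e. e \<noteq> 0 \<and> e $ 3 = 0}"
    define N where "N = max p (Polynomial.degree f)"
    obtain e :: "complex ^ 3" where e: "e \<noteq> 0" "h = hpoint e"
      "(e $ 2) ^ p * (e $ 3) ^ (N - p) =
        (\<Sum>k\<le>Polynomial.degree f. Polynomial.coeff f k * (e $ 1) ^ k * (e $ 3) ^ (N - k))"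
      using h by (auto simp: projective_completion_def Let_def N_def)
    obtain d :: "complex ^ 3" where d: "d \<noteq> 0" "d $ 3 = 0" "hpoint d = hpoint e"
      using h e(2) by auto
    obtain c where "d = c *s e" using hpoint_eqD[OF d(3)] by blast
    then have e3: "e $ 3 = 0" using d by auto
    have "(e $ 2) ^ p * 0 ^ (N - p) =
        (\<Sum>k\<le>Polynomial.degree f. if k = N then Polynomial.coeff f N * (e $ 1) ^ N else 0)"
      unfolding e(3)[unfolded e3]
      by (intro sum.cong refl) (auto simp: N_def power_0_left)
    \<comment> \<open>When N exceeds the degree, the sum has no term with k = N, and the coefficient
      on the right is 0 as well.\<close>
    also have "\<dots> = Polynomial.coeff f N * (e $ 1) ^ N"
      by (auto simp: sum.delta coeff_eq_0)
    finally have eq: "(e $ 2) ^ p * 0 ^ (N - p) = Polynomial.coeff f N * (e $ 1) ^ N" .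
    show "h \<in> insert (hpoint (vector [0, 1, 0])) ((\<lambda>b. hpoint (vector [1, b, 0])) ` ?B)"
    proof (cases "e $ 1 = 0")
      case True
      then have e_eq: "e = e $ 2 *s vector [0, 1, 0]"
        using e3 by (simp add: vec_eq_iff forall_3)
      then have "e $ 2 \<noteq> 0" using e(1) by (metis vector_smult_lzero)
      then show ?thesis using hpoint_scale e_eq e(2) by (metis insertI1)
    next
      case False
      have e_eq: "e = e $ 1 *s vector [1, e $ 2 / e $ 1, 0]"
        using e3 False by (simp add: vec_eq_iff forall_3)
      have "N = p"
      proof (rule ccontr)
        assume "N \<noteq> p"
        then have "p < N" "N = Polynomial.degree f" by (auto simp: N_def)
        then have "Polynomial.lead_coeff f * (e $ 1) ^ N = 0"
          using eq by (simp add: power_0_left)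
        then show False using False assms(2) by simp
      qed
      then have "(e $ 2 / e $ 1) ^ p = Polynomial.coeff f p"
        using eq False by (simp add: power_divide field_simps)
      moreover have "h = hpoint (vector [1, e $ 2 / e $ 1, 0])"
        using hpoint_scale[OF False] e_eq e(2) by metis
      ultimately show ?thesis by blast
    qed
  qed
qed

subsection \<open>Charts\<close>

lemma
  assumes "is_chart Y (U, w)"
  shows chart_openin: "openin Y U" and chart_open: "open (w ` U)" and chart_inj: "inj_on w U"
    and chart_image_open: "\<And>O'. openin Y O' \<Longrightarrow> open (w ` (U \<inter> O'))"
proof -
  show U: "openin Y U" and wU: "open (w ` U)"
    using assms by (auto simp: is_chart_def)
  have hom: "homeomorphic_map (subtopology Y U) (top_of_set (w ` U)) w"
    using assms by (auto simp: is_chart_def)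
  have top: "topspace (subtopology Y U) = U"
    using openin_subset[OF U] by auto
  show "inj_on w U"
    using homeomorphic_imp_injective_map[OF hom] top by simp
  show "open (w ` (U \<inter> O'))" if "openin Y O'" for O'
  proof -
    have "openin (subtopology Y U) (U \<inter> O')"
      using that by (simp add: openin_subtopology_Int2)
    then have "openin (top_of_set (w ` U)) (w ` (U \<inter> O'))"
      using homeomorphic_imp_open_map[OF hom] by (simp add: open_map_def)
    then show ?thesis using wU openin_open_trans by blast
  qed
qed

lemma chart_inv [simp]:
  assumes "is_chart Y (U, w)" "q \<in> U"
  shows "inv_into U w (w q) = q"
  using chart_inj[OF assms(1)] assms(2) by simp

subsection \<open>The normalization near a branch point\<close>

locale superelliptic_surface =
  fixes p :: nat and f :: "complex poly" and Y :: "'a topology" and A :: "'a coordinate set"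
    and \<nu> :: "'a \<Rightarrow> (complex ^ 3) set" and \<pi> :: "'a \<Rightarrow> (complex ^ 2) set"
  assumes p_pos: "0 < p" and f_nz: "f \<noteq> 0"
    and normalization: "normalization_of (projective_completion p f) Y A \<nu>"
    and x_proj: "x_projection Y A \<nu> \<pi>"
begin

lemma surface: "riemann_surface Y A"
  using normalization by (simp add: normalization_of_def)

lemma atlas_chart: "(U, w) \<in> A \<Longrightarrow> is_chart Y (U, w)"
  using surface by (auto simp: riemann_surface_def)

lemma atlas_transition:
  "(U, w) \<in> A \<Longrightarrow> (V, u) \<in> A \<Longrightarrow> (\<lambda>t. u (inv_into U w t)) holomorphic_on w ` (U \<inter> V)"
  using surface by (force simp: riemann_surface_def holomorphic_transition_def)

lemma \<nu>_mem: "q \<in> topspace Y \<Longrightarrow> \<nu> q \<in> projective_completion p f"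
  using normalization by (auto simp: normalization_of_def)

lemma \<pi>_affine:
  "q \<in> topspace Y \<Longrightarrow> \<nu> q = hpoint (vector [a, b, 1]) \<Longrightarrow> \<pi> q = hpoint (vector [a, 1])"
  using x_proj by (auto simp: x_projection_def)

lemma curve_equation:
  "q \<in> topspace Y \<Longrightarrow> \<nu> q = hpoint (vector [a, b, 1]) \<Longrightarrow> b ^ p = poly f a"
  using mem_projective_completion_affine \<nu>_mem by metis

section \<open>Finiteness of preimages and affine charts\<close>

lemma finite_preimage:
  assumes "finite H"
  shows "finite {q \<in> topspace Y. \<nu> q \<in> H}"
proof -
  obtain S where S: "finite {q \<in> topspace Y. \<nu> q \<in> S}" "inj_on \<nu> {q \<in> topspace Y. \<nu> q \<notin> S}"
    using normalization by (auto simp: normalization_of_def)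
  have "finite {q \<in> topspace Y. \<nu> q \<notin> S \<and> \<nu> q \<in> H}"
    by (rule inj_on_finite[OF _ _ assms, of \<nu>]) (use S(2) in \<open>auto simp: inj_on_def\<close>)
  with S(1) have "finite ({q \<in> topspace Y. \<nu> q \<in> S} \<union> {q \<in> topspace Y. \<nu> q \<notin> S \<and> \<nu> q \<in> H})"
    by blast
  then show ?thesis by (rule finite_subset[rotated]) auto
qed

text \<open>A nonempty open set of parameters is infinite, whereas finitely many values of \<nu>
  have only finitely many preimages. This replaces the identity theorem in excluding degenerate
  behaviour near a point.\<close>

lemma not_eventually_finite_values:
  assumes "(U, w) \<in> A" "open D" "t0 \<in> D" "D \<subseteq> w ` U" "finite H"
  shows "\<not> (\<forall>\<^sub>F t in nhds t0. \<nu> (inv_into U w t) \<in> H)"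
proof
  assume "\<forall>\<^sub>F t in nhds t0. \<nu> (inv_into U w t) \<in> H"
  then obtain S where S: "open S" "t0 \<in> S" "\<forall>t\<in>S. \<nu> (inv_into U w t) \<in> H"
    by (auto simp: eventually_nhds)
  have U: "U \<subseteq> topspace Y"
    using chart_openin[OF atlas_chart[OF assms(1)]] by (rule openin_subset)
  have "inv_into U w ` (D \<inter> S) \<subseteq> {q \<in> topspace Y. \<nu> q \<in> H}"
    using S(3) U assms(4) inv_into_into[of _ w U] by blast
  then have "finite (inv_into U w ` (D \<inter> S))"
    using finite_preimage[OF assms(5)] finite_subset by blast
  moreover have "inj_on (inv_into U w) (D \<inter> S)"
    using assms(4) by (intro inj_on_inv_into) auto
  ultimately have "finite (D \<inter> S)" by (rule finite_imageD)
  then have "D \<inter> S = {}" using S(1) assms(2) by (metis finite_imp_not_open open_Int)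
  then show False using S(2) assms(3) by blast
qed

text \<open>
  The \<open>\<pi>\<close>-fibre over a finite branch point contains no point at infinity: near a point \<open>q\<close> over \<open>s\<close>,
  the affine coordinates \<open>x = F 1 / F 3\<close> and \<open>y = F 2 / F 3\<close> converge to \<open>s\<close> and \<open>0\<close>, so \<open>F 3\<close>
  cannot vanish at \<open>q\<close>.
\<close>

lemma affine_chart:
  assumes q: "q \<in> topspace Y" and over: "\<pi> q = hpoint (vector [s, 1])" and root: "poly f s = 0"
  obtains U w D \<alpha> \<beta> where "(U, w) \<in> A" "q \<in> U" "open D" "w q \<in> D" "D \<subseteq> w ` U"
    "\<alpha> holomorphic_on D" "\<beta> holomorphic_on D" "\<alpha> (w q) = s" "\<beta> (w q) = 0"
    "\<And>t. t \<in> D \<Longrightarrow> \<nu> (inv_into U w t) = hpoint (vector [\<alpha> t, \<beta> t, 1])"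
proof -
  obtain U w D and F :: "complex \<Rightarrow> complex ^ 3" where Uw: "(U, w) \<in> A" "q \<in> U" "open D" "w q \<in> D" "D \<subseteq> w ` U"
    and F: "\<And>i. (\<lambda>t. F t $ i) holomorphic_on D" "\<And>t. t \<in> D \<Longrightarrow> F t \<noteq> 0"
      "\<And>t. t \<in> D \<Longrightarrow> \<nu> (inv_into U w t) = hpoint (F t)"
    using normalization q unfolding normalization_of_def holomorphic_to_projective_def by force
  obtain U' w' D' and G :: "complex \<Rightarrow> complex ^ 2" where Uw': "(U', w') \<in> A" "q \<in> U'" "open D'" "w' q \<in> D'" "D' \<subseteq> w' ` U'"
    and G: "\<And>i. (\<lambda>t. G t $ i) holomorphic_on D'" "\<And>t. t \<in> D' \<Longrightarrow> G t \<noteq> 0"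
      "\<And>t. t \<in> D' \<Longrightarrow> \<pi> (inv_into U' w' t) = hpoint (G t)"
    using x_proj q unfolding x_projection_def holomorphic_to_projective_def by force
  define t0 where "t0 = w q"
  have chart: "is_chart Y (U, w)" and chart': "is_chart Y (U', w')"
    using Uw(1) Uw'(1) by (simp_all add: atlas_chart)
  have Y: "inv_into U w t \<in> topspace Y" if "t \<in> D" for t
    using that Uw(5) openin_subset[OF chart_openin[OF chart]] inv_into_into[of t w U] by blast
  have cont: "isCont (\<lambda>t. F t $ i) t0" for i
    using F(1) Uw(3,4) holomorphic_on_imp_continuous_on continuous_on_eq_continuous_at
    by (metis t0_def)
  have F_lim: "((\<lambda>t. F t $ i) \<longlongrightarrow> F t0 $ i) (at t0)" for i
    using cont by (simp add: isCont_def)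
  have F3: "F t0 $ 3 \<noteq> 0"
  proof
    assume 0: "F t0 $ 3 = 0"
    \<comment> \<open>Otherwise an open set of parameters would map to the finitely many points at
      infinity.\<close>
    have "\<not> (\<forall>\<^sub>F t in nhds t0. F t $ 3 = 0)"
    proof
      assume "\<forall>\<^sub>F t in nhds t0. F t $ 3 = 0"
      moreover have "\<forall>\<^sub>F t in nhds t0. t \<in> D"
        using Uw(3,4) eventually_nhds_in_open by (simp add: t0_def)
      ultimately have "\<forall>\<^sub>F t in nhds t0. \<nu> (inv_into U w t) \<in>
          projective_completion p f \<inter> {hpoint e | e. e \<noteq> 0 \<and> e $ 3 = 0}"
        by eventually_elim (use F(2,3) \<nu>_mem Y in fastforce)
      then show False
        using not_eventually_finite_values[OF Uw(1,3) Uw(4)[folded t0_def] Uw(5)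
            finite_points_at_infinity[OF p_pos f_nz]] by simp
    qed
    then obtain g r n where "0 < r" "ball t0 r \<subseteq> D" and g:
        "\<And>t. t \<in> ball t0 r \<Longrightarrow> F t $ 3 = (t - t0) ^ n * g t" "\<And>t. t \<in> ball t0 r \<Longrightarrow> g t \<noteq> 0"
      using holomorphic_zero_factor[OF F(1)[of 3] Uw(3)] Uw(4) 0 t0_def by metis
    have "\<forall>\<^sub>F t in at t0. t \<in> ball t0 r"
      by (rule eventually_at_in_open') (use \<open>0 < r\<close> in auto)
    then have nz: "\<forall>\<^sub>F t in at t0. t \<in> D \<and> F t $ 3 \<noteq> 0"
      using eventually_neq_at_within[of t0 t0 UNIV]
      by eventually_elim (use g \<open>ball t0 r \<subseteq> D\<close> in auto)
    \<comment> \<open>The local expressions of \<nu> and \<pi> may live in different charts; this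
      transition map compares them.\<close>
    define \<phi> where "\<phi> t = w' (inv_into U w t)" for t
    have \<phi>t0: "\<phi> t0 = w' q" using chart Uw(2) by (simp add: \<phi>_def t0_def)
    have opn: "open (w ` (U \<inter> U'))"
      using chart_image_open[OF chart chart_openin[OF chart']] .
    have mem: "t0 \<in> w ` (U \<inter> U')" using Uw(2) Uw'(2) by (simp add: t0_def)
    have "\<phi> holomorphic_on w ` (U \<inter> U')"
      unfolding \<phi>_def using atlas_transition Uw(1) Uw'(1) by blast
    then have "isCont \<phi> t0"
      using opn mem holomorphic_on_imp_continuous_on continuous_on_eq_continuous_at by blast
    then have \<phi>_lim: "(\<phi> \<longlongrightarrow> w' q) (at t0)"
      by (simp add: isCont_def \<phi>t0)
    have G_lim: "((\<lambda>t. G (\<phi> t) $ i) \<longlongrightarrow> G (w' q) $ i) (at t0)" for i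
    proof -
      have "isCont (\<lambda>t. G t $ i) (w' q)"
        using G(1) Uw'(3,4) holomorphic_on_imp_continuous_on continuous_on_eq_continuous_at by metis
      then show ?thesis by (rule isCont_tendsto_compose[OF _ \<phi>_lim])
    qed
    have Gq: "G (w' q) $ 2 \<noteq> 0" "G (w' q) $ 1 / G (w' q) $ 2 = s"
      using hpoint_affine2D[of "G (w' q)" s] G(2,3)[OF Uw'(4)] over chart' Uw'(2) by auto
    have "\<forall>\<^sub>F t in at t0. t \<in> w ` (U \<inter> U')"
      using opn mem by (simp add: eventually_at_in_open')
    moreover have "\<forall>\<^sub>F t in at t0. \<phi> t \<in> D'"
      using \<phi>_lim Uw'(3,4) by (simp add: tendsto_def)
    ultimately have eqs: "\<forall>\<^sub>F t in at t0. F t $ 1 / F t $ 3 = G (\<phi> t) $ 1 / G (\<phi> t) $ 2 \<and>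
        (F t $ 2 / F t $ 3) ^ p = poly f (F t $ 1 / F t $ 3)"
      using nz
    proof eventually_elim
      case (elim t)
      have \<nu>t: "\<nu> (inv_into U w t) = hpoint (vector [F t $ 1 / F t $ 3, F t $ 2 / F t $ 3, 1])"
        using elim(3) F(3) hpoint_affine3 by metis
      obtain q' where q': "q' \<in> U" "q' \<in> U'" "t = w q'" using elim(1) by blast
      then have "inv_into U' w' (\<phi> t) = inv_into U w t"
        using chart chart' by (simp add: \<phi>_def)
      then have "hpoint (G (\<phi> t)) = hpoint (vector [F t $ 1 / F t $ 3, 1])"
        using \<pi>_affine[OF Y \<nu>t] elim(2,3) G(3) by metis
      then show ?case
        using hpoint_affine2D G(2)[OF elim(2)] curve_equation[OF Y \<nu>t] elim(3) by metis
    qed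
    have "((\<lambda>t. G (\<phi> t) $ 1 / G (\<phi> t) $ 2) \<longlongrightarrow> s) (at t0)"
      using tendsto_divide[OF G_lim[of 1] G_lim[of 2] Gq(1)] Gq(2) by simp
    then have a_lim: "((\<lambda>t. F t $ 1 / F t $ 3) \<longlongrightarrow> s) (at t0)"
      by (rule Lim_transform_eventually) (use eqs in eventually_elim, simp)
    then have "((\<lambda>t. poly f (F t $ 1 / F t $ 3)) \<longlongrightarrow> poly f s) (at t0)"
      by (rule isCont_tendsto_compose[OF poly_isCont])
    then have "((\<lambda>t. (F t $ 2 / F t $ 3) ^ p) \<longlongrightarrow> 0) (at t0)"
      unfolding root by (rule Lim_transform_eventually) (use eqs in eventually_elim, simp)
    then have b_lim: "((\<lambda>t. F t $ 2 / F t $ 3) \<longlongrightarrow> 0) (at t0)"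
      using p_pos by (rule tendsto_0_if_power_tendsto_0)
    \<comment> \<open>A component whose quotient by the third has a finite limit tends to 0 along
      with the third. Applied to x and y, this makes the whole vector vanish at \<open>t0\<close>,
      which homogeneous coordinates cannot do.\<close>
    have zero: "F t0 $ i = 0" if "((\<lambda>t. F t $ i / F t $ 3) \<longlongrightarrow> c) (at t0)" for i c
    proof -
      have "((\<lambda>t. F t $ i / F t $ 3 * F t $ 3) \<longlongrightarrow> c * 0) (at t0)"
        using that F_lim[of 3] 0 by (intro tendsto_mult) simp_all
      then have "((\<lambda>t. F t $ i) \<longlongrightarrow> c * 0) (at t0)"
        by (rule Lim_transform_eventually) (use nz in eventually_elim, simp)
      then show ?thesis using F_lim[of i] tendsto_unique[OF trivial_limit_at] by fastforce
    qed
    have "F t0 = 0"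
      using zero[OF a_lim] zero[OF b_lim] 0 by (simp add: vec_eq_iff forall_3)
    then show False using F(2) Uw(4) by (simp add: t0_def)
  qed
  define D1 where "D1 = {t \<in> D. F t $ 3 \<noteq> 0}"
  have D1: "open D1"
    using continuous_open_preimage[OF holomorphic_on_imp_continuous_on[OF F(1)[of 3]] Uw(3), of "- {0}"]
    by (simp add: D1_def vimage_def Int_def Collect_conj_eq[symmetric] open_Compl)
  define \<alpha> where "\<alpha> t = F t $ 1 / F t $ 3" for t
  define \<beta> where "\<beta> t = F t $ 2 / F t $ 3" for t
  have eq: "\<nu> (inv_into U w t) = hpoint (vector [\<alpha> t, \<beta> t, 1])" if "t \<in> D1" for t
    using that F(3) hpoint_affine3[of "F t"] by (simp add: D1_def \<alpha>_def \<beta>_def)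
  have t0: "w q \<in> D1" using F3 Uw(4) by (simp add: D1_def t0_def)
  have \<nu>q: "\<nu> q = hpoint (vector [\<alpha> (w q), \<beta> (w q), 1])"
    using eq[OF t0] chart Uw(2) by simp
  then have "\<alpha> (w q) = s"
    using \<pi>_affine[OF q \<nu>q] over hpoint_affine2D[of "vector [\<alpha> (w q), 1]" s]
    by (auto simp: vec_eq_iff forall_2)
  moreover have "\<beta> (w q) = 0"
    using curve_equation[OF q \<nu>q] root calculation p_pos by simp
  moreover have "\<alpha> holomorphic_on D1" "\<beta> holomorphic_on D1"
    unfolding \<alpha>_def \<beta>_def
    by (auto intro!: holomorphic_on_divide holomorphic_on_subset[OF F(1)] simp: D1_def)
  moreover have "D1 \<subseteq> w ` U" using Uw(5) by (auto simp: D1_def)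
  ultimately show ?thesis using that[OF Uw(1,2) D1 t0] eq by metis
qed

section \<open>Counting points in nearby fibres\<close>

lemma branch_point_exists:
  assumes "poly f s = 0"
  obtains q where "q \<in> topspace Y" "\<pi> q = hpoint (vector [s, 1])"
proof -
  have "hpoint (vector [s, 0, 1]) \<in> projective_completion p f"
    using assms p_pos by (intro affine_mem_projective_completion) simp
  then have "hpoint (vector [s, 0, 1]) \<in> \<nu> ` topspace Y"
    using normalization by (simp add: normalization_of_def)
  then obtain q where "q \<in> topspace Y" "\<nu> q = hpoint (vector [s, 0, 1])"
    by (metis imageE)
  then show ?thesis using that \<pi>_affine by blast
qed

text \<open>Over a value outside \<open>B\<close> the map \<nu> is injective, so points are
  separated by their y-coordinates, which are \<open>p\<close>-th roots of one number.\<close>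

lemma fibre_card_le:
  obtains B where "finite B"
    "\<And>a P. a \<notin> B \<Longrightarrow> finite P \<Longrightarrow> P \<subseteq> topspace Y \<Longrightarrow>
      (\<And>q. q \<in> P \<Longrightarrow> \<exists>b. \<nu> q = hpoint (vector [a, b, 1])) \<Longrightarrow> card P \<le> p"
proof -
  obtain S where S: "finite S" "inj_on \<nu> {q \<in> topspace Y. \<nu> q \<notin> S}"
    using normalization by (auto simp: normalization_of_def)
  \<comment> \<open>An element of \<open>S\<close> that is not an affine point contributes an
    unspecified value; this is harmless, since \<open>B\<close> only has to be finite and contain
    the affine first coordinates.\<close>
  define B where "B = (\<lambda>h. THE a. \<exists>b. h = hpoint (vector [a, b, 1])) ` S"
  have B: "hpoint (vector [a, b, 1]) \<notin> S" if "a \<notin> B" for a b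
  proof
    assume S: "hpoint (vector [a, b, 1]) \<in> S"
    have the: "(THE a'. \<exists>b'. hpoint (vector [a, b, 1] :: complex ^ 3) = hpoint (vector [a', b', 1])) = a"
      by (rule the_equality) (auto simp: hpoint_affine3_eq_iff)
    have "a \<in> B" unfolding B_def
      by (intro image_eqI[of _ _ "hpoint (vector [a, b, 1])"]) (simp_all only: the S)
    then show False using that by simp
  qed
  show ?thesis
  proof
    show "finite B" using S(1) by (simp add: B_def)
    fix a P
    assume a: "a \<notin> B" and P: "finite P" "P \<subseteq> topspace Y"
      and ex: "\<And>q. q \<in> P \<Longrightarrow> \<exists>b. \<nu> q = hpoint (vector [a, b, 1])"
    obtain y where y: "\<And>q. q \<in> P \<Longrightarrow> \<nu> q = hpoint (vector [a, y q, 1])"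
      using ex by metis
    have "inj_on y P"
    proof (rule inj_onI)
      fix q q' assume q: "q \<in> P" "q' \<in> P" "y q = y q'"
      then have "\<nu> q = \<nu> q'" by (simp add: y)
      moreover have "\<nu> q \<notin> S" "\<nu> q' \<notin> S" using q B[OF a] by (simp_all add: y)
      ultimately show "q = q'" using q P(2) by (intro inj_onD[OF S(2)]) auto
    qed
    moreover have "y ` P \<subseteq> {b. b ^ p = poly f a}"
      using y P(2) curve_equation by blast
    moreover have "card {b::complex. b ^ p = poly f a} \<le> p"
      using p_pos by (cases "poly f a = 0") (simp_all add: card_nth_roots)
    ultimately show "card P \<le> p"
      using card_inj_on_le[of y P] finite_nth_roots[OF p_pos] by (meson order_trans)
  qed
qed

text \<open>A chart at a point over \<open>s\<close> in which \<open>x - s\<close> vanishes to order \<open>e\<close> and \<open>y\<close> to order \<open>n\<close>\<close>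

definition branch_chart ::
    "complex \<Rightarrow> 'a \<Rightarrow> 'a set \<Rightarrow> ('a \<Rightarrow> complex) \<Rightarrow> real \<Rightarrow> nat \<Rightarrow> nat \<Rightarrow> (complex \<Rightarrow> complex) \<Rightarrow> (complex \<Rightarrow> complex) \<Rightarrow> bool"
  where
  "branch_chart s q U w r e n g k \<longleftrightarrow>
     (U, w) \<in> A \<and> q \<in> U \<and> 0 < r \<and> ball (w q) r \<subseteq> w ` U \<and> 0 < e \<and>
     g holomorphic_on ball (w q) r \<and> k holomorphic_on ball (w q) r \<and>
     (\<forall>t\<in>ball (w q) r. g t \<noteq> 0 \<and> k t \<noteq> 0 \<and>
        \<nu> (inv_into U w t) = hpoint (vector [s + (t - w q) ^ e * g t, (t - w q) ^ n * k t, 1]))"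

lemma branch_chart_exists:
  assumes q: "q \<in> topspace Y" "\<pi> q = hpoint (vector [s, 1])"
    and f: "f = [:- s, 1:] ^ v * h" "poly h s \<noteq> 0" and v: "0 < v" "coprime p v"
  obtains U w r e n g k where "branch_chart s q U w r e n g k" "p dvd e" "n * p = e * v"
proof -
  have root: "poly f s = 0" using f v(1) by simp
  obtain U w D \<alpha> \<beta> where ch: "(U, w) \<in> A" "q \<in> U" "open D" "w q \<in> D" "D \<subseteq> w ` U"
      "\<alpha> holomorphic_on D" "\<beta> holomorphic_on D" "\<alpha> (w q) = s" "\<beta> (w q) = 0"
      "\<And>t. t \<in> D \<Longrightarrow> \<nu> (inv_into U w t) = hpoint (vector [\<alpha> t, \<beta> t, 1])"
    by (rule affine_chart[OF q root]) blast
  have "inv_into U w t \<in> topspace Y" if "t \<in> D" for t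
    using that ch(5) openin_subset[OF chart_openin[OF atlas_chart[OF ch(1)]]] inv_into_into[of t w U] by blast
  then have curve: "\<beta> t ^ p = poly f (\<alpha> t)" if "t \<in> D" for t
    using that ch(10) curve_equation by blast
  then have eq: "\<beta> t ^ p = (\<alpha> t - s) ^ v * poly h (\<alpha> t)" if "t \<in> D" for t
    using that by (simp add: f(1))
  \<comment> \<open>If x were constantly s near the point, y would be 0 there, and \<nu> would be
    constant on an open set.\<close>
  have "\<not> (\<forall>\<^sub>F t in nhds (w q). \<alpha> t = s)"
  proof
    assume "\<forall>\<^sub>F t in nhds (w q). \<alpha> t = s"
    moreover have "\<forall>\<^sub>F t in nhds (w q). t \<in> D"
      using ch(3,4) by (rule eventually_nhds_in_open)
    ultimately have "\<forall>\<^sub>F t in nhds (w q). \<nu> (inv_into U w t) \<in> {hpoint (vector [s, 0, 1])}"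
    proof eventually_elim
      case (elim t)
      then have "\<beta> t = 0" using curve[of t] root p_pos by simp
      then show ?case using ch(10) elim by simp
    qed
    then show False using not_eventually_finite_values[OF ch(1,3,4,5)] by blast
  qed
  then obtain r e n g k where ord: "0 < r" "ball (w q) r \<subseteq> D" "0 < e" "p dvd e" "n * p = e * v"
    "g holomorphic_on ball (w q) r" "k holomorphic_on ball (w q) r"
    "\<And>t. t \<in> ball (w q) r \<Longrightarrow> \<alpha> t = s + (t - w q) ^ e * g t \<and> g t \<noteq> 0"
    "\<And>t. t \<in> ball (w q) r \<Longrightarrow> \<beta> t = (t - w q) ^ n * k t \<and> k t \<noteq> 0"
    by (rule order_relation[OF ch(3,4,6,7,8,9) f(2) eq _ p_pos v, rotated]) blast+
  have "branch_chart s q U w r e n g k"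
    unfolding branch_chart_def
  proof (intro conjI ballI)
    fix t assume t: "t \<in> ball (w q) r"
    then have "t \<in> D" using ord(2) by blast
    then show "\<nu> (inv_into U w t) = hpoint (vector [s + (t - w q) ^ e * g t, (t - w q) ^ n * k t, 1])"
      using ch(10) ord(8)[OF t] ord(9)[OF t] by simp
  qed (use ch ord in auto)
  then show ?thesis using that ord(4,5) by blast
qed

text \<open>In the chart, x - s has order \<open>e\<close>, so it takes every small nonzero value at
  \<open>e\<close> nearby parameters. The neighbourhood \<open>O'\<close> is kept arbitrary so that
  the fibres near two different points can be made disjoint.\<close>

lemma nearby_fibre:
  assumes bc: "branch_chart s q U w r e n g k" and O': "openin Y O'" "q \<in> O'"
  obtains \<epsilon> where "0 < \<epsilon>"
    "\<And>\<delta>. \<delta> \<noteq> 0 \<Longrightarrow> norm \<delta> < \<epsilon> \<Longrightarrow>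
      \<exists>P\<subseteq>O'. finite P \<and> card P = e \<and> (\<forall>q\<in>P. \<exists>b. \<nu> q = hpoint (vector [s + \<delta>, b, 1]))"
proof -
  have Uw: "(U, w) \<in> A" "q \<in> U" and r: "0 < r" "ball (w q) r \<subseteq> w ` U" and e: "0 < e"
    and g: "g holomorphic_on ball (w q) r" "\<And>t. t \<in> ball (w q) r \<Longrightarrow> g t \<noteq> 0"
    and \<nu>: "\<And>t. t \<in> ball (w q) r \<Longrightarrow>
      \<nu> (inv_into U w t) = hpoint (vector [s + (t - w q) ^ e * g t, (t - w q) ^ n * k t, 1])"
    using bc by (auto simp: branch_chart_def)
  have chart: "is_chart Y (U, w)" using Uw(1) by (rule atlas_chart)
  let ?W = "ball (w q) r \<inter> w ` (U \<inter> O')"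
  have W: "open ?W" "w q \<in> ?W"
    using chart_image_open[OF chart O'(1)] Uw(2) O'(2) r(1) by auto
  obtain \<epsilon> where \<epsilon>: "0 < \<epsilon>"
    "\<And>\<delta>. \<delta> \<noteq> 0 \<Longrightarrow> norm \<delta> < \<epsilon> \<Longrightarrow>
      \<exists>T\<subseteq>?W. finite T \<and> card T = e \<and> (\<forall>t\<in>T. (t - w q) ^ e * g t = \<delta>)"
    by (rule nearby_preimages[OF e r(1) g(1) refl g(2) W]) blast+
  show ?thesis
  proof
    show "0 < \<epsilon>" by fact
    fix \<delta> :: complex assume "\<delta> \<noteq> 0" "norm \<delta> < \<epsilon>"
    then obtain T where T: "T \<subseteq> ?W" "finite T" "card T = e" "\<forall>t\<in>T. (t - w q) ^ e * g t = \<delta>"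
      using \<epsilon>(2) by blast
    have "inj_on (inv_into U w) T"
      using T(1) r(2) by (intro inj_on_inv_into) auto
    then have "card (inv_into U w ` T) = e" using T(3) by (simp add: card_image)
    moreover have "inv_into U w ` T \<subseteq> O'"
      using T(1) chart by auto
    moreover have "\<exists>b. \<nu> q' = hpoint (vector [s + \<delta>, b, 1])" if "q' \<in> inv_into U w ` T" for q'
      using that \<nu> T(1,4) by fastforce
    ultimately show "\<exists>P\<subseteq>O'. finite P \<and> card P = e \<and> (\<forall>q\<in>P. \<exists>b. \<nu> q = hpoint (vector [s + \<delta>, b, 1]))"
      using T(2) by (intro exI[of _ "inv_into U w ` T"]) blast
  qed
qed

lemma exists_small_avoiding:
  assumes "finite B" "0 < \<epsilon>"
  obtains \<delta> :: complex where "\<delta> \<noteq> 0" "norm \<delta> < \<epsilon>" "s + \<delta> \<notin> B"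
proof -
  have "infinite (ball s \<epsilon>)"
    using uncountable_ball[OF assms(2), of s] countable_finite by blast
  then have "\<not> ball s \<epsilon> \<subseteq> insert s B"
    using assms(1) finite_subset by blast
  then obtain c where "c \<in> ball s \<epsilon>" "c \<notin> insert s B" by blast
  then show ?thesis
    using that[of "c - s"] by (auto simp: dist_norm norm_minus_commute)
qed

text \<open>A small \<delta> outside the exceptional set yields a fibre that contains
  \<open>e\<close> points near \<open>q\<close> but has at most \<open>p\<close> points in
  all.\<close>

lemma branch_order_le:
  assumes "branch_chart s q U w r e n g k"
  shows "e \<le> p"
proof -
  have q: "q \<in> topspace Y"
    using assms openin_subset[OF chart_openin[OF atlas_chart]] by (auto simp: branch_chart_def)
  obtain \<epsilon> where \<epsilon>: "0 < \<epsilon>" "\<And>\<delta>. \<delta> \<noteq> 0 \<Longrightarrow> norm \<delta> < \<epsilon> \<Longrightarrow> \<exists>P\<subseteq>topspace Y. finite P \<and> card P = e \<and>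
      (\<forall>q\<in>P. \<exists>b. \<nu> q = hpoint (vector [s + \<delta>, b, 1]))"
    by (rule nearby_fibre[OF assms openin_topspace q]) blast
  obtain B where B: "finite B" "\<And>a P. a \<notin> B \<Longrightarrow> finite P \<Longrightarrow> P \<subseteq> topspace Y \<Longrightarrow>
      (\<And>q. q \<in> P \<Longrightarrow> \<exists>b. \<nu> q = hpoint (vector [a, b, 1])) \<Longrightarrow> card P \<le> p"
    by (rule fibre_card_le) blast
  obtain \<delta> where \<delta>: "\<delta> \<noteq> 0" "norm \<delta> < \<epsilon>" "s + \<delta> \<notin> B"
    by (rule exists_small_avoiding[OF B(1) \<epsilon>(1)])
  obtain P where "P \<subseteq> topspace Y" "finite P" "card P = e" "\<forall>q\<in>P. \<exists>b. \<nu> q = hpoint (vector [s + \<delta>, b, 1])"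
    using \<epsilon>(2)[OF \<delta>(1,2)] by blast
  then show ?thesis using B(2)[OF \<delta>(3), of P] by simp
qed

text \<open>Two points over \<open>s\<close> would produce two disjoint sets of at least \<open>p\<close> points in a nearby fibre.\<close>

lemma branch_point_unique:
  assumes q: "q \<in> topspace Y" "\<pi> q = hpoint (vector [s, 1])"
    and q': "q' \<in> topspace Y" "\<pi> q' = hpoint (vector [s, 1])"
    and f: "f = [:- s, 1:] ^ v * h" "poly h s \<noteq> 0" and v: "0 < v" "coprime p v"
  shows "q = q'"
proof (rule ccontr)
  assume "q \<noteq> q'"
  moreover have "Hausdorff_space Y" using surface by (simp add: riemann_surface_def)
  ultimately obtain V V' where V: "openin Y V" "openin Y V'" "q \<in> V" "q' \<in> V'" "disjnt V V'"
    using q(1) q'(1) unfolding Hausdorff_space_def by metis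
  obtain U w r e n g k where bc: "branch_chart s q U w r e n g k" "p dvd e"
    by (rule branch_chart_exists[OF q f v])
  obtain U' w' r' e' n' g' k' where bc': "branch_chart s q' U' w' r' e' n' g' k'" "p dvd e'"
    by (rule branch_chart_exists[OF q' f v])
  obtain \<epsilon> where \<epsilon>: "0 < \<epsilon>" "\<And>\<delta>. \<delta> \<noteq> 0 \<Longrightarrow> norm \<delta> < \<epsilon> \<Longrightarrow> \<exists>P\<subseteq>V. finite P \<and> card P = e \<and>
      (\<forall>q\<in>P. \<exists>b. \<nu> q = hpoint (vector [s + \<delta>, b, 1]))"
    by (rule nearby_fibre[OF bc(1) V(1,3)]) blast
  obtain \<epsilon>' where \<epsilon>': "0 < \<epsilon>'" "\<And>\<delta>. \<delta> \<noteq> 0 \<Longrightarrow> norm \<delta> < \<epsilon>' \<Longrightarrow> \<exists>P\<subseteq>V'. finite P \<and> card P = e' \<and>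
      (\<forall>q\<in>P. \<exists>b. \<nu> q = hpoint (vector [s + \<delta>, b, 1]))"
    by (rule nearby_fibre[OF bc'(1) V(2,4)]) blast
  obtain B where B: "finite B" "\<And>a P. a \<notin> B \<Longrightarrow> finite P \<Longrightarrow> P \<subseteq> topspace Y \<Longrightarrow>
      (\<And>q. q \<in> P \<Longrightarrow> \<exists>b. \<nu> q = hpoint (vector [a, b, 1])) \<Longrightarrow> card P \<le> p"
    by (rule fibre_card_le) blast
  obtain \<delta> where \<delta>: "\<delta> \<noteq> 0" "norm \<delta> < min \<epsilon> \<epsilon>'" "s + \<delta> \<notin> B"
    by (rule exists_small_avoiding[OF B(1), of "min \<epsilon> \<epsilon>'"]) (use \<epsilon>(1) \<epsilon>'(1) in auto)
  obtain P where P: "P \<subseteq> V" "finite P" "card P = e" "\<forall>q\<in>P. \<exists>b. \<nu> q = hpoint (vector [s + \<delta>, b, 1])"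
    using \<epsilon>(2)[OF \<delta>(1)] \<delta>(2) by auto
  obtain P' where P': "P' \<subseteq> V'" "finite P'" "card P' = e'" "\<forall>q\<in>P'. \<exists>b. \<nu> q = hpoint (vector [s + \<delta>, b, 1])"
    using \<epsilon>'(2)[OF \<delta>(1)] \<delta>(2) by auto
  have "card (P \<union> P') \<le> p"
  proof (rule B(2)[OF \<delta>(3)])
    show "finite (P \<union> P')" using P(2) P'(2) by simp
    show "P \<union> P' \<subseteq> topspace Y"
      using P(1) P'(1) openin_subset[OF V(1)] openin_subset[OF V(2)] by blast
    show "\<exists>b. \<nu> q = hpoint (vector [s + \<delta>, b, 1])" if "q \<in> P \<union> P'" for q
      using that P(4) P'(4) by blast
  qed
  moreover have "card (P \<union> P') = e + e'"
    using P(1,2,3) P'(1,2,3) V(5) by (subst card_Un_disjoint) (auto simp: disjnt_def)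
  moreover have "0 < e" "0 < e'" using bc(1) bc'(1) by (auto simp: branch_chart_def)
  ultimately show False using bc(2) bc'(2) p_pos dvd_imp_le[of p e] dvd_imp_le[of p e'] by linarith
qed

section \<open>Multipliers of deck transformations\<close>

lemma deck_multiplier:
  assumes bc: "branch_chart s q U w r e n g k"
    and \<sigma>: "holomorphic_self_map Y A \<sigma>" "\<sigma> q = q"
    and act: "\<And>q a b. q \<in> topspace Y \<Longrightarrow> \<nu> q = hpoint (vector [a, b, 1]) \<Longrightarrow>
      \<nu> (\<sigma> q) = hpoint (vector [a, c * b, 1])"
  obtains l where "((\<lambda>t. w (\<sigma> (inv_into U w t))) has_field_derivative l) (at (w q))" "l ^ e = 1" "l ^ n = c"
proof -
  have Uw: "(U, w) \<in> A" "q \<in> U" and r: "0 < r" "ball (w q) r \<subseteq> w ` U"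
    and g: "g holomorphic_on ball (w q) r" "\<And>t. t \<in> ball (w q) r \<Longrightarrow> g t \<noteq> 0"
    and k: "k holomorphic_on ball (w q) r" "\<And>t. t \<in> ball (w q) r \<Longrightarrow> k t \<noteq> 0"
    and \<nu>: "\<And>t. t \<in> ball (w q) r \<Longrightarrow>
      \<nu> (inv_into U w t) = hpoint (vector [s + (t - w q) ^ e * g t, (t - w q) ^ n * k t, 1])"
    using bc by (auto simp: branch_chart_def)
  have chart: "is_chart Y (U, w)" using Uw(1) by (rule atlas_chart)
  have UY: "U \<subseteq> topspace Y" using openin_subset[OF chart_openin[OF chart]] .
  define T where "T t = w (\<sigma> (inv_into U w t))" for t
  define \<Omega> where "\<Omega> = w ` {q \<in> U. \<sigma> q \<in> U}"
  have "openin Y {q \<in> topspace Y. \<sigma> q \<in> U}"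
    using \<sigma>(1) chart_openin[OF chart] by (auto simp: holomorphic_self_map_def intro: openin_continuous_map_preimage)
  then have "open (w ` (U \<inter> {q \<in> topspace Y. \<sigma> q \<in> U}))"
    by (rule chart_image_open[OF chart])
  also have "U \<inter> {q \<in> topspace Y. \<sigma> q \<in> U} = {q \<in> U. \<sigma> q \<in> U}" using UY by auto
  finally have \<Omega>: "open \<Omega>" "w q \<in> \<Omega>" using Uw(2) \<sigma>(2) by (auto simp: \<Omega>_def)
  have "T holomorphic_on \<Omega>"
    using \<sigma>(1) Uw(1) unfolding holomorphic_self_map_def T_def \<Omega>_def by force
  then have T: "(T has_field_derivative deriv T (w q)) (at (w q))"
    using \<Omega> holomorphic_derivI by blast
  have Tq: "T (w q) = w q" using chart Uw(2) \<sigma>(2) by (simp add: T_def)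
  have "(T \<longlongrightarrow> w q) (nhds (w q))"
    using DERIV_isCont[OF T] tendsto_at_iff_tendsto_nhds[of T "w q"] by (simp add: isCont_def Tq)
  then have "\<forall>\<^sub>F t in nhds (w q). T t \<in> ball (w q) r"
    by (rule topological_tendstoD) (use r(1) in auto)
  moreover have "\<forall>\<^sub>F t in nhds (w q). t \<in> ball (w q) r" "\<forall>\<^sub>F t in nhds (w q). t \<in> \<Omega>"
    using eventually_nhds_in_open[of "ball (w q) r" "w q"] eventually_nhds_in_open[OF \<Omega>] r(1)
    by simp_all
  \<comment> \<open>By uniqueness of affine coordinates, these are x o \<sigma> = x and y o \<sigma>
    = c y written in the chart. Their leading terms give l^e = 1 and l^n = c.\<close>
  ultimately have eqs: "\<forall>\<^sub>F t in nhds (w q).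
      (T t - w q) ^ e * g (T t) = 1 * ((t - w q) ^ e * g t) \<and>
      (T t - w q) ^ n * k (T t) = c * ((t - w q) ^ n * k t)"
  proof eventually_elim
    case (elim t)
    obtain q' where q': "q' \<in> U" "\<sigma> q' \<in> U" "t = w q'" using elim(3) by (auto simp: \<Omega>_def)
    have inv: "inv_into U w t = q'" "inv_into U w (T t) = \<sigma> q'"
      using q' chart by (simp_all add: T_def)
    have "\<nu> (\<sigma> q') = hpoint (vector [s + (t - w q) ^ e * g t, c * ((t - w q) ^ n * k t), 1])"
      using act[of q'] \<nu>[OF elim(2)] q'(1) UY inv(1) by auto
    then show ?case
      using \<nu>[OF elim(1)] inv(2) by (simp add: hpoint_affine3_eq_iff)
  qed
  have cont: "isCont g (w q)" "isCont k (w q)"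
    using g(1) k(1) r(1) holomorphic_on_imp_continuous_on continuous_on_eq_continuous_at open_ball
    by (metis centre_in_ball)+
  have "deriv T (w q) ^ e = 1"
    by (rule multiplier_power_eq[where f = "\<lambda>t. (t - w q) ^ e * g t" and h = g, OF _ cont(1) _ T Tq])
       (use eqs g(2) r(1) in \<open>auto elim: eventually_mono\<close>)
  moreover have "deriv T (w q) ^ n = c"
    by (rule multiplier_power_eq[where f = "\<lambda>t. (t - w q) ^ n * k t" and h = k, OF _ cont(2) _ T Tq])
       (use eqs k(2) r(1) in \<open>auto elim: eventually_mono\<close>)
  ultimately show ?thesis using that T unfolding T_def by blast
qed

text \<open>Passing to another coordinate conjugates the map by a transition and its inverse, so by
  the chain rule the derivative at the fixed point is unchanged.\<close>

lemma local_coordinate_multiplier: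
  assumes Uw: "(U, w) \<in> A" "q \<in> U" and \<sigma>: "holomorphic_self_map Y A \<sigma>" "\<sigma> q = q"
    and T: "((\<lambda>t. w (\<sigma> (inv_into U w t))) has_field_derivative l) (at (w q))"
    and coord: "local_coordinate_at Y A q (U', w')"
  shows "(\<lambda>t. w' (\<sigma> (inv_into U' w' t)) - l * t) \<in> O[at 0](\<lambda>t. t ^ 2)"
proof -
  have chart: "is_chart Y (U, w)" using Uw(1) by (rule atlas_chart)
  have chart': "is_chart Y (U', w')" and q: "q \<in> U'" "w' q = 0"
    and \<phi>_hol: "(\<lambda>t. w (inv_into U' w' t)) holomorphic_on w' ` (U' \<inter> U)"
    and \<psi>_hol: "(\<lambda>t. w' (inv_into U w t)) holomorphic_on w ` (U \<inter> U')"
    using coord Uw(1) by (force simp: local_coordinate_at_def holomorphic_transition_def)+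
  have UY: "U \<subseteq> topspace Y" using openin_subset[OF chart_openin[OF chart]] .
  define \<phi> where "\<phi> t = w (inv_into U' w' t)" for t
  define \<psi> where "\<psi> t = w' (inv_into U w t)" for t
  define T where "T t = w (\<sigma> (inv_into U w t))" for t
  define T' where "T' t = w' (\<sigma> (inv_into U' w' t))" for t
  \<comment> \<open>On this set all three maps in \<psi> o T o \<phi> are defined, and the
    composition agrees with the map in the new coordinate.\<close>
  define D where "D = w' ` (U' \<inter> (U \<inter> {q \<in> topspace Y. \<sigma> q \<in> U \<inter> U'}))"
  have UU': "openin Y (U \<inter> U')" using chart_openin[OF chart] chart_openin[OF chart'] by blast
  have "openin Y {q \<in> topspace Y. \<sigma> q \<in> U \<inter> U'}"
    using \<sigma>(1) UU' openin_continuous_map_preimage unfolding holomorphic_self_map_def by blast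
  then have D: "open D" "0 \<in> D"
    unfolding D_def using chart_openin[OF chart] q Uw(2) \<sigma>(2) UY
    by (auto intro!: chart_image_open[OF chart'] openin_Int image_eqI[of _ w' q])
  have D_sub: "D \<subseteq> w' ` (U' \<inter> U)" by (auto simp: D_def)
  have \<phi>D: "\<phi> ` D \<subseteq> w ` {q \<in> U. \<sigma> q \<in> U}"
    using chart' by (auto simp: D_def \<phi>_def)
  have T\<phi>D: "(T \<circ> \<phi>) ` D \<subseteq> w ` (U \<inter> U')"
    using chart chart' by (auto simp: D_def \<phi>_def T_def)
  have conj: "(\<psi> \<circ> (T \<circ> \<phi>)) t = T' t" if "t \<in> D" for t
    using that chart chart' by (auto simp: D_def \<phi>_def T_def T'_def \<psi>_def)
  have T_hol: "T holomorphic_on w ` {q \<in> U. \<sigma> q \<in> U}"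
    using \<sigma>(1) Uw(1) unfolding holomorphic_self_map_def T_def by force
  have "(T \<circ> \<phi>) holomorphic_on D"
    using holomorphic_on_subset[OF \<phi>_hol D_sub] T_hol \<phi>D
    unfolding \<phi>_def[symmetric] by (rule holomorphic_on_compose_gen)
  then have "(\<psi> \<circ> (T \<circ> \<phi>)) holomorphic_on D"
    using \<psi>_hol T\<phi>D unfolding \<psi>_def[symmetric] by (rule holomorphic_on_compose_gen)
  then have T'_hol: "T' holomorphic_on D"
    by (rule holomorphic_transform) (rule conj)
  have \<phi>0: "\<phi> 0 = w q" and T0: "T (w q) = w q" and \<psi>0: "\<psi> (w q) = 0" and T'0: "T' 0 = 0"
    using chart_inv[OF chart Uw(2)] chart_inv[OF chart' q(1)] q(2) \<sigma>(2)
    by (simp_all add: \<phi>_def T_def \<psi>_def T'_def)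
  have \<phi>': "(\<phi> has_field_derivative deriv \<phi> 0) (at 0)"
    using holomorphic_derivI[OF holomorphic_on_subset[OF \<phi>_hol D_sub] D(1,2)]
    unfolding \<phi>_def .
  have "open (w ` (U \<inter> U'))" by (rule chart_image_open[OF chart chart_openin[OF chart']])
  then have \<psi>': "(\<psi> has_field_derivative deriv \<psi> (w q)) (at (w q))"
    using holomorphic_derivI[OF \<psi>_hol] Uw(2) q(1) unfolding \<psi>_def by blast
  have comp: "((\<psi> \<circ> \<phi>) has_field_derivative deriv \<psi> (w q) * deriv \<phi> 0) (at 0)"
    using \<phi>' \<psi>' by (intro DERIV_chain) (simp_all add: \<phi>0)
  have "(\<psi> \<circ> \<phi>) t = t" if "t \<in> D" for t
    using that chart chart' by (auto simp: D_def \<phi>_def \<psi>_def)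
  from has_field_derivative_transform_within_open[OF comp D this]
  have inverse: "deriv \<psi> (w q) * deriv \<phi> 0 = 1"
    by (rule DERIV_unique[OF _ DERIV_ident])
  have "((\<psi> \<circ> (T \<circ> \<phi>)) has_field_derivative deriv \<psi> (w q) * (l * deriv \<phi> 0)) (at 0)"
    using \<phi>' \<psi>' T by (intro DERIV_chain) (simp_all add: \<phi>0 T0 T_def[symmetric])
  then have "(T' has_field_derivative deriv \<psi> (w q) * (l * deriv \<phi> 0)) (at 0)"
    by (rule has_field_derivative_transform_within_open[OF _ D conj])
  also have "deriv \<psi> (w q) * (l * deriv \<phi> 0) = l"
    using inverse by (simp add: mult.left_commute)
  finally have "(T' has_field_derivative l) (at 0)" .
  then show ?thesis
    using linear_approximation_bigo[OF T'_hol D T'0] unfolding T'_def by simp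
qed

text \<open>This provides one coordinate centred at the point, so that the quantifier over local
  coordinates in \<open>analytic_rotation\<close> is not vacuous and its class is unique.\<close>

lemma centered_chart:
  assumes Uw: "(U, w) \<in> A" "q \<in> U"
  shows "local_coordinate_at Y A q (U, \<lambda>x. w x - w q)"
proof -
  have chart: "is_chart Y (U, w)" using Uw(1) by (rule atlas_chart)
  let ?w = "\<lambda>x. w x - w q"
  let ?tr = "\<lambda>t. t - w q"
  have img: "?w ` S = ?tr ` w ` S" for S by (simp add: image_image)
  have inj: "inj_on ?w U" using chart_inj[OF chart] by (simp add: inj_on_def)
  have inv: "inv_into U ?w (?w x) = x" if "x \<in> U" for x
    using inj that by (rule inv_into_f_f)
  have homeo: "homeomorphic_map (top_of_set (w ` U)) (top_of_set (?tr ` w ` U)) ?tr"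
    unfolding homeomorphic_map_maps homeomorphic_maps_def
    by (intro exI[of _ "\<lambda>t. t + w q"]) (auto intro!: continuous_intros)
  have "homeomorphic_map (subtopology Y U) (top_of_set (?w ` U)) ?w"
    using homeomorphic_map_compose[OF _ homeo, of "subtopology Y U" w] chart
    by (simp add: is_chart_def img comp_def)
  moreover have "open (?w ` U)"
    using open_translation_subtract[OF chart_open[OF chart]] by (simp add: img)
  ultimately have "is_chart Y (U, ?w)"
    using chart_openin[OF chart] by (simp add: is_chart_def)
  moreover have "holomorphic_transition (U, ?w) (V, u)" "holomorphic_transition (V, u) (U, ?w)"
    if "(V, u) \<in> A" for V u
  proof -
    have "((\<lambda>t. u (inv_into U w t)) \<circ> (\<lambda>t. t + w q)) holomorphic_on ?w ` (U \<inter> V)"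
      by (rule holomorphic_on_compose_gen[OF _ atlas_transition[OF Uw(1) that]])
         (auto intro!: holomorphic_intros)
    moreover have "((\<lambda>t. u (inv_into U w t)) \<circ> (\<lambda>t. t + w q)) t = u (inv_into U ?w t)"
      if "t \<in> ?w ` (U \<inter> V)" for t
      using that inv chart by auto
    ultimately show "holomorphic_transition (U, ?w) (V, u)"
      unfolding holomorphic_transition_def case_prod_conv by (rule holomorphic_transform)
    show "holomorphic_transition (V, u) (U, ?w)"
      using atlas_transition[OF that Uw(1)]
      unfolding holomorphic_transition_def by (auto intro!: holomorphic_intros)
  qed
  ultimately show ?thesis
    using Uw(2) by (auto simp: local_coordinate_at_def)
qed

section \<open>The analytic rotation number\<close>

lemma analytic_rotation_eq:
  assumes f: "f = [:- s, 1:] ^ v * h" "poly h s \<noteq> 0" and v: "0 < v" "coprime p v"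
    and \<sigma>: "holomorphic_self_map Y A \<sigma>" "\<And>q. q \<in> topspace Y \<Longrightarrow> \<sigma> q \<in> topspace Y \<and> \<pi> (\<sigma> q) = \<pi> q"
    and act: "\<And>q a b. q \<in> topspace Y \<Longrightarrow> \<nu> q = hpoint (vector [a, b, 1]) \<Longrightarrow>
      \<nu> (\<sigma> q) = hpoint (vector [a, \<zeta> * b, 1])"
    and \<zeta>: "\<zeta> = exp (2 * of_real pi * \<i> / of_nat p)" and a: "a < p" "a * v mod p = 1"
  shows "analytic_rotation p Y A \<pi> \<sigma> s = int a"
proof -
  have "poly f s = 0" using f(1) v(1) by simp
  then obtain q where q: "q \<in> topspace Y" "\<pi> q = hpoint (vector [s, 1])"
    by (rule branch_point_exists)
  have unique: "q' = q" if "q' \<in> topspace Y" "\<pi> q' = hpoint (vector [s, 1])" for q'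
    using branch_point_unique[OF that q f v] .
  have pt: "point_over Y \<pi> s = q"
    unfolding point_over_def by (rule the_equality) (use q unique in blast)+
  have \<sigma>q: "\<sigma> q = q" by (rule unique) (simp_all add: \<sigma>(2) q)
  obtain U w r e n g k where bc: "branch_chart s q U w r e n g k" "p dvd e" "n * p = e * v"
    by (rule branch_chart_exists[OF q f v])
  have Uw: "(U, w) \<in> A" "q \<in> U" "0 < e" using bc(1) by (auto simp: branch_chart_def)
  \<comment> \<open>Divisibility gives p <= e, and counting the nearby fibre gives e <= p.\<close>
  have "e = p"
    using branch_order_le[OF bc(1)] dvd_imp_le[OF bc(2) Uw(3)] by simp
  then have "n = v" using bc(3) p_pos by simp
  obtain l where l: "((\<lambda>t. w (\<sigma> (inv_into U w t))) has_field_derivative l) (at (w q))"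
      "l ^ p = 1" "l ^ v = \<zeta>"
    using deck_multiplier[OF bc(1) \<sigma>(1) \<sigma>q act] \<open>e = p\<close> \<open>n = v\<close> by metis
  \<comment> \<open>Since l^p = 1, exponents of l matter only modulo \<open>p\<close>, and a v is
    congruent to 1.\<close>
  have "l = l ^ (a * v)"
    using mult_div_mod_eq[of p "a * v"] a(2) l(2) by (metis power_add power_mult power_one power_one_right mult_1)
  also have "\<dots> = \<zeta> ^ a" using l(3) by (metis mult.commute power_mult)
  finally have l_eq: "l = \<zeta> ^ a" .
  have lin: "(\<lambda>t. w' (\<sigma> (inv_into U' w' t)) - \<zeta> ^ a * t) \<in> O[at 0](\<lambda>t. t ^ 2)"
    if "local_coordinate_at Y A q (U', w')" for U' w'
    using local_coordinate_multiplier[OF Uw(1,2) \<sigma>(1) \<sigma>q l(1) that] by (simp add: l_eq)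
  have exp_eq: "exp (2 * of_real pi * \<i> * of_int (int j) / of_nat p) = \<zeta> ^ j" for j
    by (simp add: \<zeta> exp_root_unity_power)
  show ?thesis
    unfolding analytic_rotation_def pt
  proof (rule the_equality)
    show "int a \<in> carrier (residue_ring (int p)) \<and> \<sigma> q = q \<and>
        (\<forall>U w. local_coordinate_at Y A q (U, w) \<longrightarrow>
          (\<lambda>t. w (\<sigma> (inv_into U w t)) - exp (2 * of_real pi * \<i> * of_int (int a) / of_nat p) * t)
            \<in> O[at 0](\<lambda>t. t ^ 2))"
      unfolding exp_eq using a(1) \<sigma>q lin by (auto simp: carrier_residue_ring)
  next
    fix \<rho>
    assume \<rho>: "\<rho> \<in> carrier (residue_ring (int p)) \<and> \<sigma> q = q \<and>
        (\<forall>U w. local_coordinate_at Y A q (U, w) \<longrightarrow>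
          (\<lambda>t. w (\<sigma> (inv_into U w t)) - exp (2 * of_real pi * \<i> * of_int \<rho> / of_nat p) * t)
            \<in> O[at 0](\<lambda>t. t ^ 2))"
    then obtain j where j: "\<rho> = int j" "j < p" using p_pos by (auto simp: carrier_residue_ring)
    note coord = centered_chart[OF Uw(1,2)]
    have "\<zeta> ^ j = \<zeta> ^ a"
      using linear_approximation_unique[OF _ lin[OF coord]] \<rho> coord unfolding j(1) exp_eq by blast
    then show "\<rho> = int a"
      using exp_root_unity_power_inj[of p j a] j a(1) by (simp add: \<zeta>)
  qed
qed

end

section \<open>Comparison of the two rotation data\<close>

lemma superelliptic_poly_factor:
  assumes "i \<in> {1..r}" "inj_on x {1..r}"
  obtains h where "superelliptic_poly r x v = [:- x i, 1:] ^ v i * h" "poly h (x i) \<noteq> 0"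
proof
  let ?h = "\<Prod>j\<in>{1..r} - {i}. [:- x j, 1:] ^ v j"
  show "superelliptic_poly r x v = [:- x i, 1:] ^ v i * ?h"
    unfolding superelliptic_poly_def using assms(1) by (intro prod.remove) auto
  \<comment> \<open>The branch points are distinct, so no remaining linear factor vanishes at
    \<open>x i\<close>.\<close>
  show "poly ?h (x i) \<noteq> 0"
    using assms by (auto simp: poly_prod dest: inj_onD)
qed

lemma inverse_mod_exists:
  fixes p v :: nat
  assumes "coprime v p" "1 < p"
  obtains a where "a < p" "a * v mod p = 1"
proof -
  obtain b where "[v * b = 1] (mod p)"
    using cong_solve_coprime_nat[OF assms(1)] by auto
  then have "(b mod p) * v mod p = 1"
    using assms(2) unfolding mod_mult_left_eq by (simp add: cong_def mult.commute)
  then show ?thesis using that[of "b mod p"] assms(2) by simp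
qed

theorem proposition4p19:
  fixes p r :: nat
    and x :: "nat \<Rightarrow> complex" and v :: "nat \<Rightarrow> nat"
    and R :: "complex set" and f :: "complex poly" and \<zeta> :: complex
    and Y :: "'a topology" and A :: "'a coordinate set"
    and \<nu> :: "'a \<Rightarrow> (complex ^ 3) set" and \<pi> :: "'a \<Rightarrow> (complex ^ 2) set"
    and C :: "'g monoid" and chi :: "'g \<Rightarrow> complex" and act :: "'g \<Rightarrow> 'a \<Rightarrow> 'a" and \<tau> :: 'g
    and z :: "complex \<Rightarrow> complex fls"
  defines "R \<equiv> x ` {1..r}"
    and "f \<equiv> superelliptic_poly r x v"
    and "\<zeta> \<equiv> exp (2 * of_real pi * \<i> / of_nat p)"
  assumes "Factorial_Ring.prime p" and "r \<ge> 1" and "inj_on x {1..r}"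
    and "\<And>i. i \<in> {1..r} \<Longrightarrow> 0 < v i \<and> v i < p"
    and "[(\<Sum>i=1..r. v i) = 0] (mod p)"
    and "normalization_of (projective_completion p f) Y A \<nu>"
    and "x_projection Y A \<nu> \<pi>"
    and "group C" and "cyclic_group C" and "order C = p"
    and "chi \<in> hom C (root_of_unity_group p)" and "\<exists>g\<in>carrier C. chi g \<noteq> 1"
    and "identifies_with_deck_group C chi Y A \<nu> \<pi> act"
    and "\<tau> \<in> carrier C" and "chi \<tau> = \<zeta>"
    and "\<And>s. s \<in> R \<Longrightarrow> is_uniformizer (z s)"
  shows "(\<lambda>s\<in>R. algebraic_rotation p f \<zeta> (chi \<tau>) s (z s)) \<in> (\<Pi>\<^sub>E s\<in>R. carrier (residue_ring (int p)))
       \<and> (\<lambda>s\<in>R. algebraic_rotation p f \<zeta> (chi \<tau>) s (z s)) = (\<lambda>s\<in>R. analytic_rotation p Y A \<pi> (act \<tau>) s)"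
proof -
  have p1: "1 < p" using assms(4) by (rule prime_gt_1_nat)
  have f_nz: "f \<noteq> 0" unfolding assms(2) superelliptic_poly_def by simp
  interpret superelliptic_surface p f Y A \<nu> \<pi>
    using p1 f_nz assms(9,10) by unfold_locales auto
  let ?\<sigma> = "act \<tau>"
  have "?\<sigma> \<in> carrier (deck_group Y A \<pi>)"
    using assms(16,17) by (auto simp: identifies_with_deck_group_def iso_def hom_def)
  then have bij: "bij_betw ?\<sigma> (topspace Y) (topspace Y)" and \<sigma>: "holomorphic_self_map Y A ?\<sigma>"
    and over: "\<And>q. q \<in> topspace Y \<Longrightarrow> \<pi> (?\<sigma> q) = \<pi> q"
    by (auto simp: deck_group_def Bij_def)
  have \<sigma>_over: "?\<sigma> q \<in> topspace Y \<and> \<pi> (?\<sigma> q) = \<pi> q" if "q \<in> topspace Y" for q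
    using over[OF that] bij_betwE[OF bij] that by blast
  have \<sigma>_act: "\<nu> (?\<sigma> q) = hpoint (vector [b, \<zeta> * c, 1])"
    if "q \<in> topspace Y" "\<nu> q = hpoint (vector [b, c, 1])" for q b c
    using assms(16)[unfolded identifies_with_deck_group_def, THEN conjunct2, rule_format, OF assms(17) that]
    by (simp only: assms(18))
  \<comment> \<open>The common value is the inverse of the exponent modulo \<open>p\<close>; the
    bound a < p also places it in the carrier of the residue ring.\<close>
  have data: "\<exists>a<p. algebraic_rotation p f \<zeta> (chi \<tau>) s (z s) = int a \<and>
      analytic_rotation p Y A \<pi> ?\<sigma> s = int a" if "s \<in> R" for s
  proof -
    obtain i where i: "i \<in> {1..r}" "s = x i" using \<open>s \<in> R\<close> unfolding assms(1) by blast
    have v: "0 < v i" "v i < p" using assms(7)[OF i(1)] by simp_all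
    have copr: "coprime p (v i)"
      by (rule prime_imp_coprime[OF assms(4) nat_dvd_not_less[OF v]])
    obtain h where h: "f = [:- s, 1:] ^ v i * h" "poly h s \<noteq> 0"
      unfolding assms(2) i(2) by (rule superelliptic_poly_factor[OF i(1) assms(6)])
    obtain a where a: "a < p" "a * v i mod p = 1"
      by (rule inverse_mod_exists[OF copr[unfolded coprime_commute[of p]] p1])
    have \<zeta>: "\<zeta> = exp (2 * of_real pi * \<i> / of_nat p)" by (simp add: assms(3))
    have "algebraic_rotation p f \<zeta> (chi \<tau>) s (z s) = int a"
      unfolding assms(18) by (rule algebraic_rotation_eq[OF p_pos h a assms(19)[OF that] \<zeta>])
    moreover have "analytic_rotation p Y A \<pi> ?\<sigma> s = int a"
      by (rule analytic_rotation_eq[OF h v(1) copr \<sigma> \<sigma>_over \<sigma>_act \<zeta> a])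
    ultimately show ?thesis using a(1) by blast
  qed
  have "algebraic_rotation p f \<zeta> (chi \<tau>) s (z s) \<in> carrier (residue_ring (int p))" if "s \<in> R" for s
    using data[OF that] p_pos by (auto simp: carrier_residue_ring)
  moreover have "algebraic_rotation p f \<zeta> (chi \<tau>) s (z s) = analytic_rotation p Y A \<pi> ?\<sigma> s"
    if "s \<in> R" for s
    using data[OF that] by auto
  ultimately show ?thesis by (auto simp: fun_eq_iff)
qed

end
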